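(* Let $\mu$ be a strongly Rayleigh distribution on $[m]$, let $A_1,\ldots,A_n$ be random variables counting the number of elements (of the random set sampled from $\mu$) contained in disjoint subsets of $[m]$, and fix $\kappa \in \mathbb{Z}^n$ with non-negative entries. Let $\epsilon>0$ and suppose that for all $S \subseteq [n]$ we have $$\big|\mathbb{E}_\mu[A_S] - \kappa_S\big| \leq 1-\epsilon.$$ Then $$\mathbb{P}_\mu[A_1 = \kappa_1, \dots, A_n = \kappa_n] \geq \epsilon^n \prod_{i:\,\kappa_i > 0} \frac{1}{e\sqrt{\kappa_i}}.$$ Moreover, the dependence on $\epsilon$ is tight for any fixed $\kappa$ with strictly positive entries: for every such $\kappa$ there is a constant $C$ depending only on $\kappa$ such that for every $\epsilon\in(0,1]$ there are $m$, a strongly Rayleigh distribution $\mu$ on $[m]$, and random variables $A_1,\dots,A_n$ counting the number of elements (of the random set sampled from $\mu$) contained in disjoint subsets of $[m]$, satisfying $\big|\mathbb{E}_\mu[A_S] - \kappa_S\big| \leq 1-\epsilon$ for all $S \subseteq [n]$, with $\mathbb{P}_\mu[A_1 = \kappa_1, \dots, A_n = \kappa_n] \le C\epsilon^n$.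
   Context: $A_S := \sum_{i\in S}A_i$ and $\kappa_S := \sum_{i\in S}\kappa_i$. A probability distribution $\mu$ on subsets of $[m]=\{1,\dots,m\}$ is strongly Rayleigh if its generating polynomial $g_\mu(z) = \sum_{S\subseteq[m]} \mu(S)\prod_{e\in S} z_e$ is real stable, i.e. $g_\mu(z)\ne 0$ whenever $\operatorname{Im}(z_e)>0$ for all $e$. If $T\sim\mu$ and $D_1,\dots,D_n\subseteq[m]$ are the given pairwise disjoint subsets, then $A_i=|T\cap D_i|$. *)

theory Defs
  imports "HOL-Probability.Probability"
begin

text \<open>
  A probability distribution on subsets of \<open>[m] = {1..m}\<close> is a \<open>nat set pmf\<close> whose support lies
  in \<open>Pow {1..m}\<close>. Its generating polynomial is represented by the function
  it induces on complex points \<open>z\<close>, of which only the coordinates in \<open>{1..m}\<close> matter.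
\<close>

definition generating_poly :: "nat \<Rightarrow> nat set pmf \<Rightarrow> (nat \<Rightarrow> complex) \<Rightarrow> complex" where
  "generating_poly m \<mu> z =
     (\<Sum>S\<in>Pow {1..m}. complex_of_real (pmf \<mu> S) * (\<Prod>e\<in>S. z e))"

text \<open>The coefficients of the polynomial are real, so real stability is non-vanishing on the
  product of open upper half-planes.\<close>

definition strongly_rayleigh :: "nat \<Rightarrow> nat set pmf \<Rightarrow> bool" where
  "strongly_rayleigh m \<mu> \<longleftrightarrow>
     set_pmf \<mu> \<subseteq> Pow {1..m} \<and>
     (\<forall>z. (\<forall>e\<in>{1..m}. Im (z e) > 0) \<longrightarrow> generating_poly m \<mu> z \<noteq> 0)"

definition disjoint_subsets :: "nat \<Rightarrow> nat \<Rightarrow> (nat \<Rightarrow> nat set) \<Rightarrow> bool" where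
  "disjoint_subsets m n D \<longleftrightarrow>
     (\<forall>i\<in>{1..n}. D i \<subseteq> {1..m}) \<and> disjoint_family_on D {1..n}"

text \<open>The random variable \<open>A\<^sub>i\<close>, as a function of the sampled set \<open>T\<close>.\<close>

definition count_in :: "(nat \<Rightarrow> nat set) \<Rightarrow> nat \<Rightarrow> nat set \<Rightarrow> nat" where
  "count_in D i T = card (T \<inter> D i)"

end

theory Submission
  imports Defs "HOL-Complex_Analysis.Complex_Analysis" "HOL-Computational_Algebra.Fundamental_Theorem_Algebra"
begin

text \<open>
  Let \<open>P\<close> be the joint generating polynomial of the counts \<open>A\<^sub>i\<close>. Stability says that \<open>\<partial>\<^sub>i P / P\<close> maps products
  of upper half-planes to the closed lower half-plane. Differentiating along real lines turns this into
  covariance inequalities for every exponential tilt of the distribution: distinct counts are negatively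
  correlated, and \<open>A\<^sub>i\<close> is positively correlated with \<open>A\<^sub>S\<close> for \<open>i \<in> S\<close> (the latter by the Schwarz lemma on
  the slit plane). Hence tilting by a positive multiple of \<open>A\<^sub>S\<close> raises the mean of \<open>A\<^sub>T\<close> for \<open>T \<subseteq> S\<close> and lowers
  it for \<open>T\<close> disjoint from \<open>S\<close>.

  To bound \<open>P(x) \<ge> \<epsilon>\<^sup>n x\<^sup>\<kappa>\<close> for \<open>x > 0\<close>, reach \<open>x\<close> from \<open>1\<close> by at most \<open>n\<close> tilts along the level sets of \<open>log x\<close>.
  Each tilt preserves the bounds on means needed later, and costs a factor at most \<open>\<epsilon>\<close>, because
  \<open>E e\<^bsup>tZ\<^esup> \<ge> \<epsilon>\<close> for an integer-valued \<open>Z\<close> with \<open>E Z \<ge> \<epsilon> - 1\<close> and \<open>t \<ge> 0\<close> (Bernoulli's inequality).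
  Gurvits' argument, one derivative at a time, then passes from this capacity bound to the coefficient
  of \<open>x\<^sup>\<kappa>\<close>, losing \<open>\<kappa>\<^sub>i\<^bsup>\<kappa>\<^sub>i\<^esup> e\<^bsup>-\<kappa>\<^sub>i\<^esup> / \<kappa>\<^sub>i! \<ge> 1 / (e \<surd>\<kappa>\<^sub>i)\<close> in each variable.

  Tightness is witnessed by \<open>\<Prod>\<^sub>j x\<^sub>j\<^bsup>\<kappa>\<^sub>j - 1\<^esup> (\<epsilon> x\<^sub>j + (1 - \<epsilon>) x\<^sub>j\<^sub>-\<^sub>1)\<close> with \<open>x\<^sub>0 = 1\<close>: the coefficient of \<open>x\<^sup>\<kappa>\<close> is \<open>\<epsilon>\<^sup>n\<close>.
\<close>

section \<open>Half-plane and slit-plane inequalities\<close>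

text \<open>Since \<open>h 0\<close> is real, \<open>Im (h (\<i> * t))\<close> is
  \<open>d * t\<close> up to o(t). Dividing by t > 0 and letting t tend to 0 leaves the sign of
  \<open>d\<close>.\<close>

lemma deriv_nonpos_of_Im_nonpos:
  fixes h :: "complex \<Rightarrow> complex"
  assumes deriv: "(h has_field_derivative of_real d) (at 0)" and "h 0 \<in> \<real>"
    and Im: "\<And>z. Im z > 0 \<Longrightarrow> Im (h z) \<le> 0"
  shows "d \<le> 0"
proof -
  have "((\<lambda>t::real. h (\<i> * of_real t)) has_vector_derivative \<i> * of_real d) (at 0 within {0<..})"
  proof -
    have "((\<lambda>t::real. \<i> * of_real t) has_vector_derivative \<i>) (at 0 within {0<..})"
      by (auto intro!: derivative_eq_intros)
    from field_vector_diff_chain_within[OF this, of h "of_real d"] deriv show ?thesis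
      by (auto simp: o_def intro: has_field_derivative_at_within)
  qed
  then have "((\<lambda>t::real. Im (h (\<i> * of_real t))) has_vector_derivative Im (\<i> * of_real d)) (at 0 within {0<..})"
    using bounded_linear.has_vector_derivative[OF bounded_linear_Im] by blast
  then have "((\<lambda>t::real. Im (h (\<i> * of_real t))) has_real_derivative d) (at 0 within {0<..})"
    by (simp add: has_real_derivative_iff_has_vector_derivative)
  then have "((\<lambda>t::real. (Im (h (\<i> * of_real t)) - Im (h 0)) / t) \<longlongrightarrow> d) (at 0 within {0<..})"
    by (simp add: has_field_derivative_iff)
  moreover have "Im (h 0) = 0" using assms(2) by (simp add: complex_is_Real_iff)
  ultimately have lim: "((\<lambda>t::real. Im (h (\<i> * of_real t)) / t) \<longlongrightarrow> d) (at_right 0)"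
    by simp
  have "eventually (\<lambda>t::real. Im (h (\<i> * of_real t)) / t \<le> 0) (at_right 0)"
    unfolding eventually_at_right_field
    by (rule exI[of _ 1]) (auto intro!: divide_nonpos_pos Im)
  with lim show ?thesis
    by (rule tendsto_upperbound) simp
qed

text \<open>Squaring maps the right half-plane onto the slit plane, and Cayley transforms identify
  that half-plane with the disc, with 0 corresponding to 1 at the source and to
  \<open>sqrt a\<close> at the target. The Schwarz lemma then applies at the origin.\<close>

lemma Schwarz_slit_plane:
  assumes holo: "h holomorphic_on - \<real>\<^sub>\<le>\<^sub>0" and maps: "\<And>z. z \<notin> \<real>\<^sub>\<le>\<^sub>0 \<Longrightarrow> h z \<notin> \<real>\<^sub>\<le>\<^sub>0"
    and h1: "h 1 = of_real a" "a > 0" and deriv: "(h has_field_derivative d) (at 1)"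
  shows "norm d \<le> a"
proof -
  define v where "v = (\<lambda>z::complex. (1 + z) / (1 - z))"
  define f where "f = (\<lambda>z. csqrt (h (v z ^ 2)))"
  define g where "g = (\<lambda>z. (f z - of_real (sqrt a)) / (f z + of_real (sqrt a)))"
  have ball: "z \<noteq> 1" if "norm z < 1" for z :: complex using that by auto
  have Rev: "Re (v z) > 0" if "norm z < 1" for z
  proof -
    have "Re (v z) = (1 - norm z ^ 2) / norm (1 - z) ^ 2"
      unfolding v_def cmod_power2 by (simp add: Re_divide algebra_simps power2_eq_square)
    moreover have "norm z ^ 2 < 1" using that by (simp add: power_less_one_iff abs_square_less_1)
    ultimately show ?thesis using ball[OF that] by simp
  qed
  have sq: "w ^ 2 \<notin> \<real>\<^sub>\<le>\<^sub>0" if "Re w > 0" for w :: complex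
    using that by (auto simp: complex_nonpos_Reals_iff power2_eq_square)
      (smt (verit) mult_pos_pos mult_zero_right)
  have Ref: "Re (f z) > 0" if "norm z < 1" for z
  proof -
    have "Re (f z) \<noteq> 0"
    proof
      assume "Re (f z) = 0"
      then have "f z ^ 2 \<in> \<real>\<^sub>\<le>\<^sub>0" by (simp add: complex_nonpos_Reals_iff power2_eq_square)
      moreover have "f z ^ 2 = h (v z ^ 2)" unfolding f_def by (rule power2_csqrt)
      ultimately show False using maps[OF sq[OF Rev[OF that]]] by metis
    qed
    moreover have "Re (f z) \<ge> 0" unfolding f_def by (rule Re_csqrt)
    ultimately show ?thesis by simp
  qed
  have lt1: "norm (g z) < 1" if "norm z < 1" for z
  proof -
    have "norm (f z - of_real (sqrt a)) ^ 2 < norm (f z + of_real (sqrt a)) ^ 2"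
      unfolding cmod_power2 using Ref[OF that] h1(2) by (simp add: power2_eq_square algebra_simps)
    then have "norm (f z - of_real (sqrt a)) < norm (f z + of_real (sqrt a))"
      by (simp add: power2_less_imp_less)
    then show ?thesis unfolding g_def norm_divide
      by (smt (verit) divide_less_eq_1 norm_ge_zero)
  qed
  have holv: "v holomorphic_on ball 0 1"
    unfolding v_def using ball by (intro holomorphic_intros) auto
  have "(h \<circ> (\<lambda>z. v z ^ 2)) holomorphic_on ball 0 1"
    using sq Rev by (intro holomorphic_on_compose_gen[OF _ holo] holomorphic_intros holv) auto
  then have holf: "f holomorphic_on ball 0 1"
    unfolding f_def using maps sq Rev by (intro holomorphic_on_csqrt') (auto simp: o_def)
  have nz: "f z + of_real (sqrt a) \<noteq> 0" if "norm z < 1" for z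
    using Ref[OF that] h1(2)
    by (metis Re_complex_of_real add_pos_pos less_irrefl plus_complex.sel(1) real_sqrt_gt_zero zero_complex.sel(1))
  have holg: "g holomorphic_on ball 0 1"
    unfolding g_def using nz by (intro holomorphic_intros holf) auto
  have v0: "v 0 = 1" by (simp add: v_def)
  have f0: "f 0 = of_real (sqrt a)" using h1 by (simp add: f_def v0 csqrt_of_real_nonneg)
  have g0: "g 0 = 0" by (simp add: g_def f0)
  \<comment> \<open>The chain rule collects 4 from the squared Cayley map, and a factor
    \<open>1 / (2 * sqrt a)\<close> from each of the square root and the target Cayley map.\<close>
  have dg: "(g has_field_derivative d / of_real a) (at 0)"
  proof -
    have dv: "((\<lambda>z. v z ^ 2) has_field_derivative 4) (at 0)"
      unfolding v_def by (auto intro!: derivative_eq_intros)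
    have "((\<lambda>z. h (v z ^ 2)) has_field_derivative d * 4) (at 0)"
      using DERIV_chain2[of h d "\<lambda>z. v z ^ 2", OF _ dv] deriv by (simp add: v0)
    then have df: "(f has_field_derivative d * 4 / (2 * csqrt (h (v 0 ^ 2)))) (at 0)"
      unfolding f_def using h1 by (intro has_field_derivative_csqrt') (auto simp: v0)
    have df: "(f has_field_derivative 2 * d / of_real (sqrt a)) (at 0)"
      using df h1 by (simp add: v0 csqrt_of_real_nonneg)
    have ss: "complex_of_real (sqrt a) * of_real (sqrt a) = of_real a"
      using h1(2) by (metis of_real_mult abs_of_pos real_sqrt_mult_self)
    show ?thesis unfolding g_def
      by (rule derivative_eq_intros df refl nz)+ (use h1 ss in \<open>auto simp: f0 field_simps power2_eq_square\<close>)
  qed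
  have "norm (deriv g 0) \<le> 1"
    by (rule Schwarz_Lemma(2)[OF holg g0 lt1, of 0]) auto
  then show ?thesis using DERIV_imp_deriv[OF dg] h1(2) by (simp add: norm_divide)
qed

text \<open>Adding \<open>1 / z\<close> makes the imaginary part strictly negative on the upper half plane, and its
  contributions to both sides of the Schwarz inequality cancel.\<close>

lemma deriv_ge_of_Stieltjes:
  fixes h :: "complex \<Rightarrow> complex"
  assumes holo: "h holomorphic_on - \<real>\<^sub>\<le>\<^sub>0"
    and Im: "\<And>z. Im z > 0 \<Longrightarrow> Im (h z) \<le> 0"
    and cnj: "\<And>z. h (cnj z) = cnj (h z)"
    and pos: "\<And>t. t > 0 \<Longrightarrow> Re (h (of_real t)) \<ge> 0"
    and deriv: "(h has_field_derivative of_real d) (at 1)"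
  shows "d \<ge> - Re (h 1)"
proof -
  define k where "k = (\<lambda>z. h z + 1 / z)"
  have real: "h (of_real t) \<in> \<real>" for t
    by (metis Reals_cnj_iff cnj complex_cnj_complex_of_real)
  have upper: "Im (k z) < 0" if "Im z > 0" for z
  proof -
    have "Im (1 / z) < 0" using that by (simp add: Im_divide power2_eq_square)
       (metis less_irrefl not_sum_power2_lt_zero power2_eq_square sum_power2_gt_zero_iff zero_less_divide_iff)
    then show ?thesis using Im[OF that] by (simp add: k_def)
  qed
  have kcnj: "k (cnj z) = cnj (k z)" for z by (simp add: k_def cnj)
  have "k z \<notin> \<real>\<^sub>\<le>\<^sub>0" if "z \<notin> \<real>\<^sub>\<le>\<^sub>0" for z
  proof -
    have re: "Im z = 0 \<Longrightarrow> Re z > 0" using that by (auto simp: complex_nonpos_Reals_iff)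
    show ?thesis
    proof (cases "Im z" "0::real" rule: linorder_cases)
      case greater
      then show ?thesis using upper[OF greater] by (auto simp: complex_nonpos_Reals_iff)
    next
      case less
      then have "Im (k (cnj z)) < 0" using upper[of "cnj z"] by simp
      then show ?thesis by (auto simp: complex_nonpos_Reals_iff kcnj)
    next
      case equal
      then have z: "z = of_real (Re z)" by (simp add: complex_eq_iff)
      have "Re (k (of_real (Re z))) > 0"
        using pos[OF re] re equal by (simp add: k_def Re_divide power2_eq_square add_nonneg_pos)
      then show ?thesis by (subst z) (auto simp: complex_nonpos_Reals_iff)
    qed
  qed
  moreover have "k holomorphic_on - \<real>\<^sub>\<le>\<^sub>0"
    unfolding k_def by (intro holomorphic_intros holo) auto
  moreover have "k 1 = of_real (Re (h 1) + 1)"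
    using real[of 1] by (simp add: k_def complex_eq_iff complex_is_Real_iff)
  moreover have "Re (h 1) + 1 > 0" using pos[of 1] by simp
  moreover have "(k has_field_derivative of_real (d - 1)) (at 1)"
    unfolding k_def by (auto intro!: derivative_eq_intros deriv)
  ultimately have "norm (complex_of_real (d - 1)) \<le> Re (h 1) + 1"
    using Schwarz_slit_plane by blast
  then show ?thesis unfolding norm_of_real by linarith
qed

text \<open>The logarithmic derivative is the sum of \<open>1 / (s - r)\<close> over the roots, all
  of which lie in the closed lower half-plane. The induction splits off one root at a time.\<close>

lemma Im_logderiv_nonpos:
  fixes p :: "complex poly"
  assumes "\<And>z. Im z > 0 \<Longrightarrow> poly p z \<noteq> 0" and "Im s > 0"
  shows "Im (poly (pderiv p) s / poly p s) \<le> 0"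
  using assms
proof (induction "degree p" arbitrary: p)
  case 0
  then show ?case by (metis pderiv_eq_0_iff div_0 poly_0 zero_complex.sel(2) order_refl)
next
  case (Suc d)
  then have "\<not> constant (poly p)" by (simp add: constant_degree)
  then obtain r where "poly p r = 0" using fundamental_theorem_of_algebra by blast
  then obtain q where p: "p = [:- r, 1:] * q" by (auto simp: poly_eq_0_iff_dvd)
  have "p \<noteq> 0" using Suc.hyps(2) by auto
  then have "d = degree q" using Suc.hyps(2) unfolding p by (subst (asm) degree_mult_eq) auto
  moreover have "poly q z \<noteq> 0" if "Im z > 0" for z using Suc.prems(1)[OF that] p by auto
  ultimately have q: "Im (poly (pderiv q) s / poly q s) \<le> 0" "poly q s \<noteq> 0"
    using Suc.hyps(1) Suc.prems(2) by auto
  have "Im r \<le> 0" using Suc.prems(1)[of r] \<open>poly p r = 0\<close> by force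
  then have "Im (s - r) > 0" using Suc.prems(2) by simp
  then have "Im (1 / (s - r)) \<le> 0" "s - r \<noteq> 0"
    by (auto simp: Im_divide intro!: divide_nonpos_nonneg)
  moreover have "poly (pderiv p) s / poly p s = 1 / (s - r) + poly (pderiv q) s / poly q s"
    using q(2) \<open>s - r \<noteq> 0\<close> unfolding p pderiv_mult by (simp add: pderiv_pCons field_simps)
  ultimately show ?case using q(1) by simp
qed

section \<open>Stable polynomials and covariances\<close>

text \<open>Monomials are indexed by an abstract finite set, and different indices may carry the
  same exponents. So the subsets of [m] can later serve as indices themselves, and differentiation
  changes coefficients and exponents but never the index set.\<close>

locale nonneg_poly =
  fixes V :: "'v set" and K :: "'k set"
  assumes fin: "finite V" "finite K"
begin

text \<open>Generic in the field, because one polynomial is evaluated at complex points for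
  stability and at positive real points for probabilities.\<close>

definition ev :: "('k \<Rightarrow> real) \<Rightarrow> ('k \<Rightarrow> 'v \<Rightarrow> nat) \<Rightarrow> ('v \<Rightarrow> 'a::real_normed_field) \<Rightarrow> 'a" where
  "ev c \<alpha> z = (\<Sum>k\<in>K. of_real (c k) * (\<Prod>i\<in>V. z i ^ \<alpha> k i))"

definition stable :: "('k \<Rightarrow> real) \<Rightarrow> ('k \<Rightarrow> 'v \<Rightarrow> nat) \<Rightarrow> bool" where
  "stable c \<alpha> \<longleftrightarrow> (\<forall>k\<in>K. c k \<ge> 0) \<and>
     (\<forall>z::'v \<Rightarrow> complex. (\<forall>i\<in>V. Im (z i) > 0) \<longrightarrow> ev c \<alpha> z \<noteq> 0)"

text \<open>
  Coefficients and exponents of the partial derivative in direction \<open>j\<close>. Where the exponent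
  subtraction truncates, the coefficient vanishes.
\<close>

abbreviation pdc :: "'v \<Rightarrow> ('k \<Rightarrow> real) \<Rightarrow> ('k \<Rightarrow> 'v \<Rightarrow> nat) \<Rightarrow> 'k \<Rightarrow> real" where
  "pdc j c \<alpha> \<equiv> \<lambda>k. c k * real (\<alpha> k j)"

abbreviation pde :: "'v \<Rightarrow> ('k \<Rightarrow> 'v \<Rightarrow> nat) \<Rightarrow> 'k \<Rightarrow> 'v \<Rightarrow> nat" where
  "pde j \<alpha> \<equiv> \<lambda>k. (\<alpha> k)(j := \<alpha> k j - 1)"

lemma ev_of_real: "ev c \<alpha> (\<lambda>i. of_real (x i)) = (of_real (ev c \<alpha> x) :: 'a::real_normed_field)"
  by (simp add: ev_def)

lemma ev_cong: "(\<And>i. i \<in> V \<Longrightarrow> z i = w i) \<Longrightarrow> ev c \<alpha> z = ev c \<alpha> w"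
  by (auto simp: ev_def intro!: sum.cong prod.cong)

lemma ev_cnj: "ev c \<alpha> (\<lambda>i. cnj (z i)) = cnj (ev c \<alpha> z)"
  by (simp add: ev_def)

lemma ev_nonneg:
  fixes x :: "'v \<Rightarrow> real"
  assumes "\<And>k. k \<in> K \<Longrightarrow> c k \<ge> 0" "\<And>i. i \<in> V \<Longrightarrow> x i \<ge> 0"
  shows "ev c \<alpha> x \<ge> 0"
  unfolding ev_def using assms by (auto intro!: sum_nonneg mult_nonneg_nonneg prod_nonneg)

lemma ev_pos:
  fixes x :: "'v \<Rightarrow> real"
  assumes "\<And>k. k \<in> K \<Longrightarrow> c k \<ge> 0" "\<And>i. i \<in> V \<Longrightarrow> x i > 0" "k \<in> K" "c k > 0"
  shows "ev c \<alpha> x > 0"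
proof -
  have m: "(\<Prod>i\<in>V. x i ^ \<alpha> k i) > 0" for k using assms(2) by (auto intro!: prod_pos)
  show ?thesis unfolding ev_def
    using assms fin less_imp_le[OF m] by (intro sum_pos2[of _ k]) (auto intro!: mult_pos_pos m)
qed

lemma stable_nonneg: "stable c \<alpha> \<Longrightarrow> k \<in> K \<Longrightarrow> c k \<ge> 0"
  by (simp add: stable_def)

lemma stable_nonzero: "stable c \<alpha> \<Longrightarrow> (\<And>i. i \<in> V \<Longrightarrow> Im (z i) > 0) \<Longrightarrow> ev c \<alpha> z \<noteq> 0"
  by (simp add: stable_def)

lemma stable_obtain:
  assumes "stable c \<alpha>" obtains k where "k \<in> K" "c k > 0"
proof -
  have "ev c \<alpha> (\<lambda>_. \<i>) \<noteq> 0" by (rule stable_nonzero[OF assms]) simp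
  then obtain k where "k \<in> K" "c k \<noteq> 0" unfolding ev_def
    by (metis (no_types, lifting) mult_zero_left of_real_0 sum.not_neutral_contains_not_neutral)
  with that show ?thesis using stable_nonneg[OF assms] by fastforce
qed

lemma stable_pos:
  fixes x :: "'v \<Rightarrow> real"
  assumes "stable c \<alpha>" "\<And>i. i \<in> V \<Longrightarrow> x i > 0" shows "ev c \<alpha> x > 0"
  using assms by (metis ev_pos stable_nonneg stable_obtain)

section \<open>Partial derivatives and preservation of stability\<close>

lemma monomial_split:
  assumes "j \<in> V"
  shows "(\<Prod>i\<in>V. z i ^ \<alpha> i) = z j ^ \<alpha> j * (\<Prod>i\<in>V-{j}. z i ^ \<alpha> i)"
  using assms fin by (simp add: prod.remove)

text \<open>The Euler operator keeps the exponents and multiplies each coefficient by its exponent,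
  so derivatives become unnormalised expectations.\<close>

lemma mult_ev_pd:
  assumes "j \<in> V"
  shows "z j * ev (pdc j c \<alpha>) (pde j \<alpha>) z = ev (pdc j c \<alpha>) \<alpha> z"
proof -
  have "z j * (of_real (pdc j c \<alpha> k) * (\<Prod>i\<in>V. z i ^ pde j \<alpha> k i)) =
        of_real (pdc j c \<alpha> k) * (\<Prod>i\<in>V. z i ^ \<alpha> k i)" for k
  proof (cases "\<alpha> k j")
    case (Suc a)
    then show ?thesis by (simp add: monomial_split[OF assms])
  qed simp
  then show ?thesis unfolding ev_def sum_distrib_left by (intro sum.cong refl)
qed

lemma deriv_ev_line:
  fixes x y :: "'v \<Rightarrow> 'a::real_normed_field"
  shows "((\<lambda>t. ev c \<alpha> (\<lambda>i. x i + t * y i)) has_field_derivative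
     (\<Sum>j\<in>V. y j * ev (pdc j c \<alpha>) (pde j \<alpha>) (\<lambda>i. x i + t * y i))) (at t)"
proof -
  have "(\<Sum>j\<in>V. y j * ev (pdc j c \<alpha>) (pde j \<alpha>) (\<lambda>i. x i + t * y i)) =
     (\<Sum>k\<in>K. of_real (c k) * (\<Sum>j\<in>V. of_nat (\<alpha> k j) * (x j + t * y j) ^ (\<alpha> k j - 1) * y j *
         (\<Prod>i\<in>V-{j}. (x i + t * y i) ^ \<alpha> k i)))"
    unfolding ev_def sum_distrib_left
    by (subst sum.swap) (auto intro!: sum.cong simp: monomial_split mult_ac)
  then show ?thesis unfolding ev_def
    by (auto intro!: derivative_eq_intros has_field_derivative_prod simp: sum_distrib_left mult_ac)
qed

text \<open>With all other variables frozen in the upper half-plane, stability leaves a univariate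
  polynomial in \<open>z j\<close> without zeros there, and \<open>Im_logderiv_nonpos\<close>
  applies.\<close>

lemma Im_pd_over_nonpos:
  assumes st: "stable c \<alpha>" and j: "j \<in> V" and z: "\<And>i. i \<in> V \<Longrightarrow> Im (z i) > 0"
  shows "Im (ev (pdc j c \<alpha>) (pde j \<alpha>) z / ev c \<alpha> z) \<le> 0"
proof -
  define p where "p = (\<Sum>k\<in>K. monom (of_real (c k) * (\<Prod>i\<in>V-{j}. z i ^ \<alpha> k i)) (\<alpha> k j))"
  have p: "poly p s = ev c \<alpha> (z(j := s))" for s
    using j by (auto simp: p_def ev_def poly_sum poly_monom monomial_split intro!: sum.cong prod.cong)
  have pderiv_sum: "pderiv (sum f A) = (\<Sum>k\<in>A. pderiv (f k))" for f :: "'k \<Rightarrow> complex poly" and A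
    by (induction A rule: infinite_finite_induct) (auto simp: pderiv_add)
  have p': "poly (pderiv p) s = ev (pdc j c \<alpha>) (pde j \<alpha>) (z(j := s))" for s
    using j by (auto simp: p_def ev_def pderiv_sum pderiv_monom poly_sum poly_monom monomial_split
        intro!: sum.cong prod.cong)
  have "poly p s \<noteq> 0" if "Im s > 0" for s
    unfolding p using that z by (intro stable_nonzero[OF st]) auto
  from Im_logderiv_nonpos[OF this, of "z j"] show ?thesis
    using z j by (simp add: p p')
qed

text \<open>On a line through a hypothetical zero, the quotient of derivative and polynomial has
  nonpositive imaginary part and attains the boundary value 0. The open mapping theorem makes it
  constant, so the derivative vanishes on the whole line, contradicting positivity at its points
  with positive real coordinates.\<close>

lemma stable_pd:
  assumes st: "stable c \<alpha>" and j: "j \<in> V" and nz: "k \<in> K" "c k * real (\<alpha> k j) > 0"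
  shows "stable (pdc j c \<alpha>) (pde j \<alpha>)"
  unfolding stable_def
proof (intro conjI ballI allI impI)
  show "pdc j c \<alpha> k \<ge> 0" if "k \<in> K" for k using stable_nonneg[OF st that] by simp
  fix z :: "'v \<Rightarrow> complex" assume z: "\<forall>i\<in>V. Im (z i) > 0"
  \<comment> \<open>The line passes through \<open>z\<close> at t = \<i>, and its direction
    \<open>Im z\<close> is positive, so the upper half-plane of t is sent into the product of upper
    half-planes.\<close>
  define l where "l = (\<lambda>t i. of_real (Re (z i)) + t * complex_of_real (Im (z i)))"
  define f where "f = (\<lambda>t. ev (pdc j c \<alpha>) (pde j \<alpha>) (l t))"
  define g where "g = (\<lambda>t. ev c \<alpha> (l t))"
  define H where "H = {t. Im t > 0}"
  have H: "open H" "connected H" "\<i> \<in> H"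
    by (auto simp: H_def open_halfspace_Im_gt intro!: convex_connected convex_halfspace_Im_gt)
  have lH: "Im (l t i) > 0" if "t \<in> H" "i \<in> V" for t i
    using that z by (auto simp: l_def H_def)
  have gnz: "g t \<noteq> 0" if "t \<in> H" for t
    unfolding g_def by (rule stable_nonzero[OF st]) (use lH that in auto)
  have li: "l \<i> = z" by (rule ext) (simp add: l_def complex_eq_iff)
  have hol: "f holomorphic_on S" "g holomorphic_on S" for S
    unfolding f_def g_def l_def
    by (rule holomorphic_onI, rule field_differentiable_at_within,
        unfold field_differentiable_def, rule exI, rule deriv_ev_line)+
  show "ev (pdc j c \<alpha>) (pde j \<alpha>) z \<noteq> 0"
  proof
    assume "ev (pdc j c \<alpha>) (pde j \<alpha>) z = 0"
    then have fi: "f \<i> = 0" by (simp add: f_def li)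
    define q where "q = (\<lambda>t. f t / g t)"
    have q: "q holomorphic_on H" unfolding q_def using gnz by (intro holomorphic_intros hol) auto
    have Imq: "Im (q t) \<le> 0" if "t \<in> H" for t
      unfolding q_def f_def g_def by (rule Im_pd_over_nonpos[OF st j]) (use lH that in auto)
    have "q constant_on H"
    \<comment> \<open>An open image containing 0 would contain some \<open>\<i> * e\<close> with e >
      0, against \<open>Imq\<close>.\<close>
    proof (rule ccontr)
      assume "\<not> q constant_on H"
      then have "open (q ` H)" using open_mapping_thm[OF q] H by blast
      moreover have "0 \<in> q ` H" using H(3) fi by (force simp: q_def)
      ultimately obtain e where e: "e > 0" "cball 0 e \<subseteq> q ` H"
        by (meson open_contains_cball)
      then have "\<i> * of_real e \<in> q ` H" by (auto simp: norm_mult)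
      then obtain t where "t \<in> H" "q t = \<i> * of_real e" by auto
      then show False using Imq[of t] e(1) by simp
    qed
    then obtain a where "\<And>t. t \<in> H \<Longrightarrow> q t = a" by (auto simp: constant_on_def)
    moreover have "q \<i> = 0" by (simp add: q_def fi)
    ultimately have "q t = 0" if "t \<in> H" for t using that H(3) by metis
    then have fH: "f t = 0" if "t \<in> H" for t using that gnz[OF that] by (auto simp: q_def)
    have f0: "f w = 0" for w
    proof (rule analytic_continuation_open[of H UNIV f "\<lambda>_. 0"])
      show "H \<noteq> {}" using H(3) by auto
    qed (use H fH hol in auto)
    \<comment> \<open>A real parameter so large that every coordinate of the line is
      positive.\<close>
    obtain R where R: "\<And>i. i \<in> V \<Longrightarrow> Re (z i) + R * Im (z i) > 0"
    proof
      define R where "R = (\<Sum>i\<in>V. \<bar>Re (z i)\<bar> / Im (z i)) + 1"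
      fix i assume i: "i \<in> V"
      have "\<bar>Re (z i)\<bar> / Im (z i) \<le> (\<Sum>i\<in>V. \<bar>Re (z i)\<bar> / Im (z i))"
        using i fin z by (intro member_le_sum) (auto intro!: divide_nonneg_pos)
      then have "\<bar>Re (z i)\<bar> / Im (z i) < R" by (simp add: R_def)
      then show "Re (z i) + R * Im (z i) > 0" using z i by (auto simp: field_simps abs_if split: if_splits)
    qed
    have "f (of_real R) = of_real (ev (pdc j c \<alpha>) (pde j \<alpha>) (\<lambda>i. Re (z i) + R * Im (z i)))"
      by (simp add: f_def l_def flip: ev_of_real)
    moreover have "ev (pdc j c \<alpha>) (pde j \<alpha>) (\<lambda>i. Re (z i) + R * Im (z i)) > 0"
      using stable_nonneg[OF st] R nz by (intro ev_pos[of _ _ k]) auto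
    ultimately show False using f0[of "of_real R"] by simp
  qed
qed

section \<open>Covariance inequalities from stability\<close>

text \<open>
  Expectation and covariance are not normalised: they carry factors \<open>ev c \<alpha> x\<close> and \<open>(ev c \<alpha> x)\<^sup>2\<close>.
\<close>

definition mean :: "('k \<Rightarrow> real) \<Rightarrow> ('k \<Rightarrow> 'v \<Rightarrow> nat) \<Rightarrow> ('v \<Rightarrow> real) \<Rightarrow> ('k \<Rightarrow> real) \<Rightarrow> real" where
  "mean c \<alpha> x f = ev (\<lambda>k. c k * f k) \<alpha> x"

definition cov :: "('k \<Rightarrow> real) \<Rightarrow> ('k \<Rightarrow> 'v \<Rightarrow> nat) \<Rightarrow> ('v \<Rightarrow> real) \<Rightarrow> 'v \<Rightarrow> 'v \<Rightarrow> real" where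
  "cov c \<alpha> x i j = mean c \<alpha> x (\<lambda>k. real (\<alpha> k i) * real (\<alpha> k j)) * ev c \<alpha> x
     - mean c \<alpha> x (\<lambda>k. real (\<alpha> k i)) * mean c \<alpha> x (\<lambda>k. real (\<alpha> k j))"

text \<open>For i = j, differentiating twice produces the falling factorial a (a - 1) of the
  exponent, which is the source of the subtracted mean.\<close>

lemma mult_ev_pd2:
  fixes x :: "'v \<Rightarrow> real"
  assumes "i \<in> V" "j \<in> V"
  shows "x i * (x j * ev (pdc j (pdc i c \<alpha>) (pde i \<alpha>)) (pde j (pde i \<alpha>)) x) =
    mean c \<alpha> x (\<lambda>k. real (\<alpha> k i) * real (\<alpha> k j)) - (if i = j then mean c \<alpha> x (\<lambda>k. real (\<alpha> k i)) else 0)"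
proof -
  have "x i * ev (\<lambda>k. (c k * real (pde i \<alpha> k j)) * real (\<alpha> k i)) (pde i \<alpha>) x =
        ev (\<lambda>k. (c k * real (pde i \<alpha> k j)) * real (\<alpha> k i)) \<alpha> x"
    using mult_ev_pd[OF assms(1), of x "\<lambda>k. c k * real (pde i \<alpha> k j)" \<alpha>] .
  also have "\<dots> = mean c \<alpha> x (\<lambda>k. real (\<alpha> k i) * real (\<alpha> k j)) - (if i = j then mean c \<alpha> x (\<lambda>k. real (\<alpha> k i)) else 0)"
  proof -
    have r: "real (a - Suc 0) * real a = real a * real a - real a" for a by (cases a) (auto simp: algebra_simps)
    have *: "c k * real (pde i \<alpha> k j) * real (\<alpha> k i) =
        c k * (real (\<alpha> k i) * real (\<alpha> k j)) - (if i = j then c k * real (\<alpha> k i) else 0)" for k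
      using arg_cong[OF r[of "\<alpha> k j"], of "\<lambda>t. c k * t"]
      by (cases "i = j") (simp_all add: algebra_simps)
    show ?thesis unfolding * mean_def ev_def
      by (simp add: left_diff_distrib sum_subtractf)
  qed
  finally show ?thesis
    unfolding mult_ev_pd[OF assms(2), of x "pdc i c \<alpha>" "pde i \<alpha>"] by (simp only: mult_ac)
qed

text \<open>In terms of the logarithmic velocities \<open>y j / x j\<close>, the derivative of
  \<partial>_i P / P is a weighted sum of covariances, apart from the normalisation and the diagonal
  correction coming from \<open>mult_ev_pd2\<close>.\<close>

lemma deriv_logderiv_line:
  fixes u y :: "'v \<Rightarrow> real" and t :: real
  defines "x \<equiv> \<lambda>i. u i + t * y i"
  assumes i: "i \<in> V" and x: "\<And>j. j \<in> V \<Longrightarrow> x j > 0" and P: "ev c \<alpha> x > 0"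
  shows "((\<lambda>s. ev (pdc i c \<alpha>) (pde i \<alpha>) (\<lambda>i. of_real (u i) + s * of_real (y i)) /
              ev c \<alpha> (\<lambda>i. of_real (u i) + s * of_real (y i))) has_field_derivative
          complex_of_real (((\<Sum>j\<in>V. y j / x j * cov c \<alpha> x i j)
             - y i / x i * mean c \<alpha> x (\<lambda>k. real (\<alpha> k i)) * ev c \<alpha> x) / (x i * ev c \<alpha> x ^ 2)))
         (at (of_real t))"
proof -
  define N where "N = ev (pdc i c \<alpha>) (pde i \<alpha>) x"
  define N' where "N' = (\<lambda>j. ev (pdc j (pdc i c \<alpha>) (pde i \<alpha>)) (pde j (pde i \<alpha>)) x)"
  define P' where "P' = (\<lambda>j. ev (pdc j c \<alpha>) (pde j \<alpha>) x)"
  have l: "of_real (u i) + of_real t * of_real (y i) = complex_of_real (x i)" for i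
    by (simp add: x_def)
  have "((\<lambda>s. ev (pdc i c \<alpha>) (pde i \<alpha>) (\<lambda>i. of_real (u i) + s * of_real (y i)) /
              ev c \<alpha> (\<lambda>i. of_real (u i) + s * of_real (y i))) has_field_derivative
          complex_of_real (((\<Sum>j\<in>V. y j * N' j) * ev c \<alpha> x - N * (\<Sum>j\<in>V. y j * P' j)) / (ev c \<alpha> x * ev c \<alpha> x)))
         (at (of_real t))"
    using P by (intro DERIV_cong[OF DERIV_divide[OF deriv_ev_line deriv_ev_line]])
      (auto simp: l ev_of_real N_def N'_def P'_def)
  moreover have "((\<Sum>j\<in>V. y j * N' j) * ev c \<alpha> x - N * (\<Sum>j\<in>V. y j * P' j)) * x i =
     (\<Sum>j\<in>V. y j / x j * cov c \<alpha> x i j) - y i / x i * mean c \<alpha> x (\<lambda>k. real (\<alpha> k i)) * ev c \<alpha> x"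
  proof -
    have 1: "x i * (y j * N' j) = y j / x j * (mean c \<alpha> x (\<lambda>k. real (\<alpha> k i) * real (\<alpha> k j)) - (if i = j then mean c \<alpha> x (\<lambda>k. real (\<alpha> k i)) else 0))"
      if "j \<in> V" for j
      unfolding mult_ev_pd2[OF i that, symmetric] using x[OF that] by (simp add: N'_def)
    have 2: "y j * P' j = y j / x j * mean c \<alpha> x (\<lambda>k. real (\<alpha> k j))" if "j \<in> V" for j
      using mult_ev_pd[OF that, of x c \<alpha>] x[OF that] by (simp add: P'_def mean_def field_simps)
    have 3: "N * x i = mean c \<alpha> x (\<lambda>k. real (\<alpha> k i))"
      using mult_ev_pd[OF i, of x c \<alpha>] by (simp add: N_def mean_def mult_ac)
    have "((\<Sum>j\<in>V. y j * N' j) * ev c \<alpha> x - N * (\<Sum>j\<in>V. y j * P' j)) * x i =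
      (\<Sum>j\<in>V. x i * (y j * N' j)) * ev c \<alpha> x - (N * x i) * (\<Sum>j\<in>V. y j * P' j)"
      by (simp add: sum_distrib_left algebra_simps)
    also have "\<dots> = (\<Sum>j\<in>V. y j / x j * (mean c \<alpha> x (\<lambda>k. real (\<alpha> k i) * real (\<alpha> k j)) - (if i = j then mean c \<alpha> x (\<lambda>k. real (\<alpha> k i)) else 0)) * ev c \<alpha> x
        - mean c \<alpha> x (\<lambda>k. real (\<alpha> k i)) * (y j / x j * mean c \<alpha> x (\<lambda>k. real (\<alpha> k j))))"
      unfolding 3 sum_subtractf sum_distrib_left sum_distrib_right
      by (intro arg_cong2[of _ _ _ _ "(-)"] sum.cong refl) (simp_all only: 1 2)
    also have "\<dots> = (\<Sum>j\<in>V. y j / x j * cov c \<alpha> x i j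
        - (if i = j then y i / x i * mean c \<alpha> x (\<lambda>k. real (\<alpha> k i)) * ev c \<alpha> x else 0))"
      by (intro sum.cong refl) (simp add: cov_def algebra_simps)
    finally show ?thesis using i fin by (simp add: sum_subtractf)
  qed
  then have "((\<Sum>j\<in>V. y j * N' j) * ev c \<alpha> x - N * (\<Sum>j\<in>V. y j * P' j)) / (ev c \<alpha> x * ev c \<alpha> x) =
     ((\<Sum>j\<in>V. y j / x j * cov c \<alpha> x i j) - y i / x i * mean c \<alpha> x (\<lambda>k. real (\<alpha> k i)) * ev c \<alpha> x)
       / (x i * ev c \<alpha> x ^ 2)"
    using x[OF i] P by (simp add: divide_eq_eq eq_divide_eq power2_eq_square)
  ultimately show ?thesis by (simp only:)
qed

text \<open>Along the line from \<open>x\<close> with velocity \<open>w j * x j\<close>, the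
  quotient \<partial>_i P / P is real at 0 and maps the upper half-plane to the closed lower one.
  Hence its derivative at 0 is nonpositive.\<close>

lemma sum_cov_le:
  assumes st: "stable c \<alpha>" and i: "i \<in> V" and x: "\<And>j. j \<in> V \<Longrightarrow> x j > 0"
    and w: "\<And>j. j \<in> V \<Longrightarrow> w j > 0"
  shows "(\<Sum>j\<in>V. w j * cov c \<alpha> x i j) \<le> w i * mean c \<alpha> x (\<lambda>k. real (\<alpha> k i)) * ev c \<alpha> x"
proof -
  define y where "y = (\<lambda>j. w j * x j)"
  define h where "h = (\<lambda>s. ev (pdc i c \<alpha>) (pde i \<alpha>) (\<lambda>i. of_real (x i) + s * of_real (y i)) /
              ev c \<alpha> (\<lambda>i. of_real (x i) + s * complex_of_real (y i)))"
  have P: "ev c \<alpha> x > 0" by (rule stable_pos[OF st x])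
  define d where "d = ((\<Sum>j\<in>V. w j * cov c \<alpha> x i j)
             - w i * mean c \<alpha> x (\<lambda>k. real (\<alpha> k i)) * ev c \<alpha> x) / (x i * ev c \<alpha> x ^ 2)"
  have yx: "y j / x j = w j" if "j \<in> V" for j using x[OF that] by (simp add: y_def)
  have "(h has_field_derivative of_real d) (at 0)"
    using deriv_logderiv_line[OF i, of x 0 y c \<alpha>] x P i by (simp add: h_def d_def yx)
  moreover have "h 0 = of_real (ev (pdc i c \<alpha>) (pde i \<alpha>) x / ev c \<alpha> x)"
    by (simp add: h_def ev_of_real)
  then have "h 0 \<in> \<real>" by simp
  moreover have "Im (h s) \<le> 0" if "Im s > 0" for s
    unfolding h_def using that x w by (intro Im_pd_over_nonpos[OF st i]) (simp add: y_def)
  ultimately have "d \<le> 0" by (rule deriv_nonpos_of_Im_nonpos)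
  moreover have "x i * ev c \<alpha> x ^ 2 > 0" using x[OF i] P by simp
  ultimately show ?thesis unfolding d_def by (simp add: divide_le_0_iff not_le)
qed

text \<open>Here \<open>x\<close> is reached at parameter 1 from the nonnegative point
  \<open>(1 - w) x\<close>, so the quotient is holomorphic on the whole slit plane and nonnegative
  on the positive axis. This gives the lower bound of \<open>deriv_ge_of_Stieltjes\<close>.\<close>

lemma sum_cov_ge:
  assumes st: "stable c \<alpha>" and i: "i \<in> V" and x: "\<And>j. j \<in> V \<Longrightarrow> x j > 0"
    and w: "\<And>j. j \<in> V \<Longrightarrow> w j > 0" "\<And>j. j \<in> V \<Longrightarrow> w j \<le> 1" and wi: "w i = 1"
  shows "(\<Sum>j\<in>V. w j * cov c \<alpha> x i j) \<ge> 0"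
proof -
  define y where "y = (\<lambda>j. w j * x j)"
  define u where "u = (\<lambda>j. (1 - w j) * x j)"
  define l where "l = (\<lambda>s i. of_real (u i) + s * complex_of_real (y i))"
  define h where "h = (\<lambda>s. ev (pdc i c \<alpha>) (pde i \<alpha>) (l s) / ev c \<alpha> (l s))"
  have P: "ev c \<alpha> x > 0" by (rule stable_pos[OF st x])
  define d where "d = ((\<Sum>j\<in>V. w j * cov c \<alpha> x i j)
             - w i * mean c \<alpha> x (\<lambda>k. real (\<alpha> k i)) * ev c \<alpha> x) / (x i * ev c \<alpha> x ^ 2)"
  have yx: "y j / x j = w j" if "j \<in> V" for j using x[OF that] by (simp add: y_def)
  have ux: "(\<lambda>i. u i + 1 * y i) = x" by (rule ext) (simp add: u_def y_def algebra_simps)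
  have upos: "u j \<ge> 0" "y j > 0" if "j \<in> V" for j
    using that x[OF that] w[OF that] by (auto simp: u_def y_def)
  have deriv: "(h has_field_derivative of_real d) (at 1)"
  proof -
    have uxi: "u i + 1 * y i = x i" for i using ux by metis
    have "d = ((\<Sum>j\<in>V. y j / x j * cov c \<alpha> x i j)
             - y i / x i * mean c \<alpha> x (\<lambda>k. real (\<alpha> k i)) * ev c \<alpha> x) / (x i * ev c \<alpha> x ^ 2)"
      using i by (simp add: d_def yx)
    then show ?thesis
      using deriv_logderiv_line[OF i, of u 1 y c \<alpha>, unfolded uxi, OF x P]
      unfolding h_def l_def by (simp only: of_real_1)
  qed
  have lreal: "ev c \<alpha> (l (of_real t)) = of_real (ev c \<alpha> (\<lambda>i. u i + t * y i))" for t c \<alpha>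
    by (simp add: l_def flip: ev_of_real)
  have lpos: "u j + t * y j > 0" if "t > 0" "j \<in> V" for t j
    using upos[OF that(2)] that(1) by (simp add: add_nonneg_pos)
  have lcnj: "l (cnj s) = (\<lambda>i. cnj (l s i))" for s by (simp add: l_def fun_eq_iff)
  have hcnj: "h (cnj s) = cnj (h s)" for s by (simp add: h_def lcnj ev_cnj)
  have nz_up: "ev c \<alpha> (l s) \<noteq> 0" if "Im s > 0" for s
    using that upos by (intro stable_nonzero[OF st]) (simp add: l_def)
  have nz: "ev c \<alpha> (l s) \<noteq> 0" if "s \<notin> \<real>\<^sub>\<le>\<^sub>0" for s
  proof (cases "Im s" "0::real" rule: linorder_cases)
    case less
    then have "ev c \<alpha> (l (cnj s)) \<noteq> 0" by (intro nz_up) simp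
    then show ?thesis by (simp add: lcnj ev_cnj)
  next
    case equal
    then have s: "s = of_real (Re s)" "Re s > 0"
      using that by (auto simp: complex_eq_iff complex_nonpos_Reals_iff)
    have "ev c \<alpha> (\<lambda>i. u i + Re s * y i) > 0" by (rule stable_pos[OF st lpos[OF s(2)]])
    then have "ev c \<alpha> (l (of_real (Re s))) \<noteq> 0" unfolding lreal by simp
    then show ?thesis by (subst s(1))
  qed (rule nz_up)
  have hol: "(\<lambda>s. ev c \<alpha> (l s)) holomorphic_on S" for c \<alpha> S
    unfolding l_def
    by (rule holomorphic_onI, rule field_differentiable_at_within,
        unfold field_differentiable_def, rule exI, rule deriv_ev_line)
  have "d \<ge> - Re (h 1)"
  proof (rule deriv_ge_of_Stieltjes[OF _ _ hcnj _ deriv])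
    show "h holomorphic_on - \<real>\<^sub>\<le>\<^sub>0"
      unfolding h_def using nz by (intro holomorphic_intros hol) auto
    show "Im (h s) \<le> 0" if "Im s > 0" for s
      unfolding h_def using that upos by (intro Im_pd_over_nonpos[OF st i]) (simp add: l_def)
    show "Re (h (of_real t)) \<ge> 0" if "t > 0" for t
      unfolding h_def lreal using stable_nonneg[OF st] lpos[OF that]
      by (simp flip: of_real_divide) (intro divide_nonneg_nonneg ev_nonneg; force intro: less_imp_le)
  qed
  moreover have "Re (h 1) = mean c \<alpha> x (\<lambda>k. real (\<alpha> k i)) / (x i * ev c \<alpha> x)"
  proof -
    have "Re (h 1) = ev (pdc i c \<alpha>) (pde i \<alpha>) x / ev c \<alpha> x"
      using lreal[of _ _ 1] unfolding ux h_def by (simp flip: of_real_divide)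
    also have "\<dots> = x i * ev (pdc i c \<alpha>) (pde i \<alpha>) x / (x i * ev c \<alpha> x)"
      using x[OF i] by simp
    finally show ?thesis unfolding mult_ev_pd[OF i, of x c \<alpha>] mean_def .
  qed
  \<comment> \<open>As \<open>w i = 1\<close>, the diagonal correction in \<open>d\<close> is
    exactly \<open>- Re (h 1)\<close>. It cancels against the lower bound and leaves only
    covariances.\<close>
  moreover have "d = ((\<Sum>j\<in>V. w j * cov c \<alpha> x i j) / (x i * ev c \<alpha> x ^ 2)) - mean c \<alpha> x (\<lambda>k. real (\<alpha> k i)) / (x i * ev c \<alpha> x)"
    using x[OF i] P by (simp add: d_def wi field_simps power2_eq_square)
  ultimately have "(\<Sum>j\<in>V. w j * cov c \<alpha> x i j) / (x i * ev c \<alpha> x ^ 2) \<ge> 0" by linarith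
  moreover have "x i * ev c \<alpha> x ^ 2 > 0" using x[OF i] P by simp
  ultimately show ?thesis by (simp add: zero_le_divide_iff not_le)
qed

text \<open>Stability speaks about strictly positive weights. Letting e tend to 0 reaches weights
  that vanish outside a chosen set.\<close>

lemma le_of_small_perturbations:
  fixes a b c d :: real
  assumes "\<And>e. 0 < e \<Longrightarrow> e \<le> 1 \<Longrightarrow> a + e * b \<le> c + e * d"
  shows "a \<le> c"
proof (rule tendsto_le[of "at_right 0" "\<lambda>e. c + e * d" c "\<lambda>e. a + e * b" a])
  show "eventually (\<lambda>e. a + e * b \<le> c + e * d) (at_right 0)"
    using assms by (auto simp: eventually_at_right_field intro!: exI[of _ 1])
qed (auto intro!: tendsto_eq_intros)

lemma sum_weight:
  fixes g :: "'v \<Rightarrow> real"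
  assumes "S \<subseteq> V"
  shows "(\<Sum>j\<in>V. (if j \<in> S then 1 else e) * g j) = (\<Sum>j\<in>S. g j) + e * (\<Sum>j\<in>V-S. g j)"
  using assms fin by (subst sum.subset_diff[OF assms]) (auto simp: sum_distrib_left)

text \<open>In \<open>sum_cov_le\<close> take weight 1 at \<open>j\<close> and e elsewhere. For i
  \<noteq> j the right side also carries the factor e and disappears in the limit, giving negative
  correlation; the case i = j yields log-concavity in each variable.\<close>

lemma cov_le:
  assumes st: "stable c \<alpha>" and i: "i \<in> V" and j: "j \<in> V" and x: "\<And>j. j \<in> V \<Longrightarrow> x j > 0"
  shows "cov c \<alpha> x i j \<le> (if i = j then mean c \<alpha> x (\<lambda>k. real (\<alpha> k i)) * ev c \<alpha> x else 0)"
proof -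
  define m where "m = mean c \<alpha> x (\<lambda>k. real (\<alpha> k i)) * ev c \<alpha> x"
  define s where "s = (\<Sum>l\<in>V-{j}. cov c \<alpha> x i l)"
  have "cov c \<alpha> x i j + e * s \<le> (if i = j then m else 0) + e * (if i = j then 0 else m)" if "e > 0" for e
  proof -
    have "(\<Sum>l\<in>V. (if l \<in> {j} then 1 else e) * cov c \<alpha> x i l)
        \<le> (if i \<in> {j} then 1 else e) * mean c \<alpha> x (\<lambda>k. real (\<alpha> k i)) * ev c \<alpha> x"
      by (rule sum_cov_le[OF st i]) (use x that in auto)
    then show ?thesis
      unfolding sum_weight[of "{j}" e "cov c \<alpha> x i", OF insert_subsetI[OF j empty_subsetI]]
      by (auto simp: s_def m_def)
  qed
  then have "cov c \<alpha> x i j \<le> (if i = j then m else 0)"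
    by (rule le_of_small_perturbations)
  then show ?thesis unfolding m_def .
qed

text \<open>In \<open>sum_cov_ge\<close> take weight 1 on \<open>S\<close>, which contains
  \<open>i\<close>, and e outside, then let e tend to 0.\<close>

lemma cov_sum_nonneg:
  assumes st: "stable c \<alpha>" and i: "i \<in> S" and S: "S \<subseteq> V" and x: "\<And>j. j \<in> V \<Longrightarrow> x j > 0"
  shows "(\<Sum>j\<in>S. cov c \<alpha> x i j) \<ge> 0"
proof -
  have "0 \<le> (\<Sum>j\<in>S. cov c \<alpha> x i j) + e * (\<Sum>l\<in>V-S. cov c \<alpha> x i l)" if "e > 0" "e \<le> 1" for e
  proof -
    have "(\<Sum>l\<in>V. (if l \<in> S then 1 else e) * cov c \<alpha> x i l) \<ge> 0"
      by (rule sum_cov_ge[OF st]) (use x that i S in auto)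
    then show ?thesis unfolding sum_weight[OF S, of e "cov c \<alpha> x i"] .
  qed
  then have "0 + e * 0 \<le> (\<Sum>j\<in>S. cov c \<alpha> x i j) + e * (\<Sum>l\<in>V-S. cov c \<alpha> x i l)" if "e > 0" "e \<le> 1" for e
    using that by simp
  then show ?thesis by (rule le_of_small_perturbations)
qed

end

section \<open>From capacity to coefficients\<close>

text \<open>The function v^n exp (- v) is largest at v = n. For n > 0 this is the n-th power of 1 +
  t \<le> exp t at t = v / n - 1.\<close>

lemma power_le_exp:
  fixes v :: real
  assumes "v \<ge> 0"
  shows "v ^ n \<le> real n ^ n * exp (v - real n)"
proof (cases "n = 0")
  case False
  have "v / real n \<le> exp (v / real n - 1)"
    using exp_ge_add_one_self[of "v / real n - 1"] by simp
  then have "(v / real n) ^ n \<le> exp (v / real n - 1) ^ n"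
    using assms by (intro power_mono) auto
  also have "\<dots> = exp (v - real n)"
    using False by (simp flip: exp_of_nat_mult add: right_diff_distrib)
  finally show ?thesis using False by (simp add: power_divide field_simps)
qed (use assms in simp)

section \<open>Gurvits' inequality, one derivative at a time\<close>

context nonneg_poly
begin

lemma deriv_ev_upd:
  fixes x :: "'v \<Rightarrow> real"
  assumes j: "j \<in> V"
  shows "((\<lambda>t. ev c \<alpha> (x(j := t))) has_field_derivative ev (pdc j c \<alpha>) (pde j \<alpha>) (x(j := t))) (at t)"
proof -
  define y where "y = (\<lambda>i. if i = j then 1 else 0 :: real)"
  have upd: "(\<lambda>i. (x(j := 0)) i + s * y i) = x(j := s)" for s by (auto simp: y_def)
  have "(\<Sum>i\<in>V. y i * f i) = f j" for f :: "'v \<Rightarrow> real"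
  proof -
    have "(\<Sum>i\<in>V. y i * f i) = (\<Sum>i\<in>V. if i = j then f i else 0)"
      by (intro sum.cong) (auto simp: y_def)
    then show ?thesis using j fin by simp
  qed
  then show ?thesis using deriv_ev_line[of c \<alpha> "x(j := 0)" y t] unfolding upd by simp
qed

text \<open>The diagonal case of \<open>cov_le\<close>: removing the mean from the second moment
  turns it into P'' P \<le> P'^2, that is, log-concavity in \<open>x j\<close>.\<close>

lemma ev_pd2_le:
  fixes x :: "'v \<Rightarrow> real"
  assumes st: "stable c \<alpha>" and j: "j \<in> V" and x: "\<And>i. i \<in> V \<Longrightarrow> x i > 0"
  shows "ev (pdc j (pdc j c \<alpha>) (pde j \<alpha>)) (pde j (pde j \<alpha>)) x * ev c \<alpha> x \<le> ev (pdc j c \<alpha>) (pde j \<alpha>) x ^ 2"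
proof -
  define N where "N = ev (pdc j c \<alpha>) (pde j \<alpha>) x"
  define N' where "N' = ev (pdc j (pdc j c \<alpha>) (pde j \<alpha>)) (pde j (pde j \<alpha>)) x"
  have 1: "x j * (x j * N') = mean c \<alpha> x (\<lambda>k. real (\<alpha> k j) * real (\<alpha> k j)) - mean c \<alpha> x (\<lambda>k. real (\<alpha> k j))"
    unfolding N'_def mult_ev_pd2[OF j j] by simp
  have 2: "x j * N = mean c \<alpha> x (\<lambda>k. real (\<alpha> k j))"
    unfolding N_def mult_ev_pd[OF j] mean_def ..
  have "x j * (x j * N') * ev c \<alpha> x - (x j * N) * (x j * N) \<le> 0"
    using cov_le[OF st j j, of x] x unfolding 1 2 cov_def by (simp add: algebra_simps)
  then have "x j ^ 2 * (N' * ev c \<alpha> x - N ^ 2) \<le> 0"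
    by (simp add: power2_eq_square algebra_simps)
  then show ?thesis using x[OF j] by (simp add: mult_le_0_iff N_def N'_def)
qed

text \<open>Log-concavity in the coordinate \<open>j\<close> places log P below its tangent at
  \<open>x j\<close>.\<close>

lemma ev_upd_le_exp:
  fixes x :: "'v \<Rightarrow> real"
  assumes st: "stable c \<alpha>" and j: "j \<in> V" and x: "\<And>i. i \<in> V \<Longrightarrow> x i > 0" and "s > 0"
  shows "ev c \<alpha> (x(j := s)) \<le> ev c \<alpha> x * exp (ev (pdc j c \<alpha>) (pde j \<alpha>) x / ev c \<alpha> x * (s - x j))"
proof -
  define G where "G = (\<lambda>t. ev c \<alpha> (x(j := t)))"
  define G' where "G' = (\<lambda>t. ev (pdc j c \<alpha>) (pde j \<alpha>) (x(j := t)))"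
  define G'' where "G'' = (\<lambda>t. ev (pdc j (pdc j c \<alpha>) (pde j \<alpha>)) (pde j (pde j \<alpha>)) (x(j := t)))"
  have G: "(G has_field_derivative G' t) (at t)" "(G' has_field_derivative G'' t) (at t)" for t
    unfolding G_def G'_def G''_def using deriv_ev_upd[OF j] by blast+
  have xt: "(x(j := t)) i > 0" if "t > 0" "i \<in> V" for t i using that x by simp
  have Gpos: "G t > 0" if "t > 0" for t unfolding G_def by (rule stable_pos[OF st xt[OF that]])
  have dln: "((\<lambda>t. - ln (G t)) has_real_derivative - (G' t / G t)) (at t)" if "t > 0" for t
    using Gpos[OF that] by (auto intro!: derivative_eq_intros G)
  have conv: "convex_on {0<..} (\<lambda>t. - ln (G t))"
  proof (rule f''_ge0_imp_convex)
    fix t :: real assume t: "t \<in> {0<..}"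
    then have Gt: "G t > 0" using Gpos by simp
    show "((\<lambda>t. - ln (G t)) has_real_derivative - (G' t / G t)) (at t)"
      using t by (intro dln) simp
    show "((\<lambda>t. - (G' t / G t)) has_real_derivative (G' t ^ 2 - G'' t * G t) / G t ^ 2) (at t)"
      using Gt by (auto intro!: derivative_eq_intros G simp: power2_eq_square field_simps)
    show "0 \<le> (G' t ^ 2 - G'' t * G t) / G t ^ 2"
    proof -
      have "G'' t * G t \<le> G' t ^ 2"
        unfolding G_def G'_def G''_def by (rule ev_pd2_le[OF st j]) (use xt t in auto)
      then show ?thesis by simp
    qed
  qed simp
  have xj: "x j > 0" by (rule x[OF j])
  have "- (G' (x j) / G (x j)) * (s - x j) \<le> - ln (G s) - (- ln (G (x j)))"
  proof (rule convex_on_imp_above_tangent[OF conv])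
    show "((\<lambda>t. - ln (G t)) has_real_derivative - (G' (x j) / G (x j))) (at (x j) within {0<..})"
      by (rule has_field_derivative_at_within[OF dln[OF xj]])
    show "x j \<in> interior {0<..}" "s \<in> {0<..}" using xj \<open>s > 0\<close> by (auto simp: interior_open)
  qed (rule connected_Ioi)
  then have "ln (G s) \<le> ln (G (x j)) + G' (x j) / G (x j) * (s - x j)" by simp
  then have "exp (ln (G s)) \<le> exp (ln (G (x j)) + G' (x j) / G (x j) * (s - x j))" by simp
  then show ?thesis
    using Gpos[OF xj] Gpos[OF \<open>s > 0\<close>] by (simp add: exp_add G_def G'_def)
qed

text \<open>Gurvits' step. The tangent bound holds for every s > 0; the best s and
  \<open>power_le_exp\<close> eliminate the slope \<open>r\<close>. The bound is proved at every
  positive \<open>x j\<close>, not only in the limit \<open>x j\<close> = 0, so that the same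
  variable can be differentiated again.\<close>

lemma ev_pd_ge:
  fixes x :: "'v \<Rightarrow> real"
  assumes st: "stable c \<alpha>" and j: "j \<in> V" and x: "\<And>i. i \<in> V \<Longrightarrow> x i > 0" and "C \<ge> 0"
    and le: "\<And>s. s > 0 \<Longrightarrow> C * s ^ Suc n \<le> ev c \<alpha> (x(j := s))"
  shows "C * (real (Suc n) ^ Suc n / (exp 1 * real n ^ n)) * x j ^ n \<le> ev (pdc j c \<alpha>) (pde j \<alpha>) x"
proof -
  define P where "P = ev c \<alpha> x"
  define r where "r = ev (pdc j c \<alpha>) (pde j \<alpha>) x / P"
  have P: "P > 0" unfolding P_def by (rule stable_pos[OF st x])
  have N: "ev (pdc j c \<alpha>) (pde j \<alpha>) x = r * P" using P by (simp add: r_def)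
  have "ev (pdc j c \<alpha>) (pde j \<alpha>) x \<ge> 0"
    using stable_nonneg[OF st] x by (intro ev_nonneg) (auto intro: less_imp_le)
  then have r0: "r \<ge> 0" using P by (simp add: r_def)
  have tangent: "C * s ^ Suc n \<le> P * exp (r * (s - x j))" if "s > 0" for s
    unfolding P_def r_def by (rule order_trans[OF le[OF that] ev_upd_le_exp[OF st j x that]])
  have xj: "x j > 0" by (rule x[OF j])
  show ?thesis
  proof (cases "r = 0")
    case True
    have "C = 0"
    proof (rule ccontr)
      assume "C \<noteq> 0"
      then have C: "C > 0" using \<open>C \<ge> 0\<close> by simp
      \<comment> \<open>If the slope vanished, C s^(n+1) would stay below P for all s; this
        \<open>s\<close> makes already \<open>C * s\<close> exceed P.\<close>
      define s where "s = P / C + 1"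
      have "s \<ge> 1" using P C by (simp add: s_def)
      then have "s ^ 1 \<le> s ^ Suc n" by (intro power_increasing) auto
      then have "C * s \<le> C * s ^ Suc n" using C by simp
      also have "\<dots> \<le> P" using tangent[of s] \<open>s \<ge> 1\<close> True by simp
      moreover have "C * s = P + C" using C by (simp add: s_def distrib_left)
      ultimately show False using C by linarith
    qed
    then show ?thesis using N True by simp
  next
    case False
    then have r: "r > 0" using r0 by simp
    define k where "k = real (Suc n)"
    have k: "k > 0" by (simp add: k_def)
    \<comment> \<open>\<open>k / r\<close> minimises \<open>exp (r s) / s\<^sup>k\<close> over \<open>s > 0\<close>.\<close>
    have "C * (k / r) ^ Suc n \<le> P * exp (k - r * x j)"
      using tangent[of "k / r"] r k by (simp add: right_diff_distrib del: power_Suc)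
    then have "C * k ^ Suc n \<le> P * exp (k - r * x j) * r ^ Suc n"
      using r by (simp add: power_divide divide_le_eq del: power_Suc)
    \<comment> \<open>The factor \<open>(r * x j) ^ n\<close> is chosen so that
      \<open>power_le_exp\<close> cancels \<open>exp (- r * x j)\<close>, leaving exp (k - n) = exp
      1.\<close>
    then have "C * k ^ Suc n * (r * x j) ^ n \<le> P * exp (k - r * x j) * r ^ Suc n * (r * x j) ^ n"
      using r xj by (intro mult_right_mono) auto
    also have "\<dots> \<le> P * exp (k - r * x j) * r ^ Suc n * (real n ^ n * exp (r * x j - real n))"
      using r xj P by (intro mult_left_mono power_le_exp) auto
    also have "\<dots> = r ^ n * (r * P * (exp 1 * real n ^ n))"
    proof -
      have "exp (k - r * x j) * exp (r * x j - real n) = exp 1"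
        by (simp add: k_def flip: exp_add)
      then show ?thesis by (simp add: mult_ac)
    qed
    finally have "r ^ n * (C * k ^ Suc n * x j ^ n) \<le> r ^ n * (r * P * (exp 1 * real n ^ n))"
      by (simp add: power_mult_distrib mult_ac)
    then have "C * k ^ Suc n * x j ^ n \<le> r * P * (exp 1 * real n ^ n)" using r by simp
    moreover have "exp 1 * real n ^ n > (0::real)" by (cases "n = 0") auto
    ultimately show ?thesis unfolding N k_def by (simp add: field_simps)
  qed
qed

text \<open>Induction on the total degree of \<kappa>. The factors (n+1)^(n+1) / (e n^n) of the
  single derivatives telescope to \<kappa>^\<kappa> exp (- \<kappa>) in each variable, while
  differentiation multiplies the wanted coefficients by \<kappa>!.\<close>

lemma coefficient_ge:
  assumes "stable c \<alpha>" "I \<subseteq> V" "C \<ge> 0"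
    and "\<And>x. (\<And>i. i \<in> V \<Longrightarrow> x i > 0) \<Longrightarrow> (\<And>i. i \<notin> I \<Longrightarrow> x i = 1) \<Longrightarrow>
          C * (\<Prod>i\<in>I. x i ^ \<kappa> i) \<le> ev c \<alpha> x"
  shows "C * (\<Prod>i\<in>I. real (\<kappa> i) ^ \<kappa> i * exp (- real (\<kappa> i)) / fact (\<kappa> i)) \<le>
     (\<Sum>k | k \<in> K \<and> (\<forall>i\<in>I. \<alpha> k i = \<kappa> i). c k)"
  using assms
proof (induction "\<Sum>i\<in>I. \<kappa> i" arbitrary: c \<alpha> \<kappa> C)
  case 0
  have finI: "finite I" using 0(3) fin finite_subset by blast
  then have k0: "\<kappa> i = 0" if "i \<in> I" for i using 0(1) that by simp
  \<comment> \<open>With \<kappa> = 0 on \<open>I\<close>, sending the variables in \<open>I\<close>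
    to 0 keeps exactly the monomials free of them.\<close>
  define x where "x = (\<lambda>(e::real) i. if i \<in> I then e else 1)"
  have lim: "((\<lambda>e. ev c \<alpha> (x e)) \<longlongrightarrow> ev c \<alpha> (x 0)) (at_right 0)"
    unfolding ev_def x_def by (auto intro!: tendsto_eq_intros)
  have "eventually (\<lambda>e. C \<le> ev c \<alpha> (x e)) (at_right 0)"
  proof -
    have "C \<le> ev c \<alpha> (x e)" if "e > 0" for e
      using 0(5)[of "x e"] that by (simp add: x_def k0)
    then show ?thesis by (auto simp: eventually_at_right_field intro!: exI[of _ 1])
  qed
  with lim have "C \<le> ev c \<alpha> (x 0)" by (rule tendsto_lowerbound) simp
  also have "\<dots> = (\<Sum>k\<in>K. if \<forall>i\<in>I. \<alpha> k i = \<kappa> i then c k else 0)"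
    unfolding ev_def
  proof (rule sum.cong)
    fix k
    have "(\<Prod>i\<in>V. x 0 i ^ \<alpha> k i) = (if \<forall>i\<in>I. \<alpha> k i = \<kappa> i then 1 else 0)"
    proof (cases "\<forall>i\<in>I. \<alpha> k i = \<kappa> i")
      case True
      then show ?thesis using k0 by (auto simp: x_def intro!: prod.neutral)
    next
      case False
      then show ?thesis using k0 fin 0(3) by (auto simp: x_def prod_zero_iff)
    qed
    then show "of_real (c k) * (\<Prod>i\<in>V. x 0 i ^ \<alpha> k i) = (if \<forall>i\<in>I. \<alpha> k i = \<kappa> i then c k else 0)"
      by simp
  qed simp
  also have "\<dots> = (\<Sum>k | k \<in> K \<and> (\<forall>i\<in>I. \<alpha> k i = \<kappa> i). c k)"
    using fin by (simp add: sum.If_cases Int_def)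
  finally show ?case using k0 by simp
next
  case (Suc N)
  have finI: "finite I" using Suc(4) fin finite_subset by blast
  obtain j where j: "j \<in> I" "\<kappa> j \<noteq> 0"
    using Suc(2) by (metis nat.distinct(1) sum.neutral)
  then have jV: "j \<in> V" using Suc(4) by auto
  obtain n where n: "\<kappa> j = Suc n" using j(2) not0_implies_Suc by blast
  define \<kappa>' where "\<kappa>' = \<kappa>(j := n)"
  define g where "g = real (Suc n) ^ Suc n / (exp 1 * real n ^ n)"
  have npos: "real n ^ n > 0" by (cases "n = 0") auto
  have g: "g > 0" using npos by (simp add: g_def del: power_Suc)
  show ?case
  \<comment> \<open>For C > 0 the capacity bound shows that the derivative is not the zero
    polynomial, as its stability requires.\<close>
  proof (cases "C = 0")
    case True
    then show ?thesis using stable_nonneg[OF Suc(3)] by (auto intro!: sum_nonneg)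
  next
    case False
    then have C: "C > 0" using Suc(5) by simp
    have split: "(\<Prod>i\<in>I. f i) = f j * (\<Prod>i\<in>I-{j}. f i)" for f :: "'v \<Rightarrow> real"
      using finI j(1) by (rule prod.remove)
    have rest: "(\<Prod>i\<in>I-{j}. f i (\<kappa>' i)) = (\<Prod>i\<in>I-{j}. f i (\<kappa> i))" for f :: "'v \<Rightarrow> nat \<Rightarrow> real"
      by (intro prod.cong) (auto simp: \<kappa>'_def)
    have le: "C * g * (\<Prod>i\<in>I. x i ^ \<kappa>' i) \<le> ev (pdc j c \<alpha>) (pde j \<alpha>) x"
      if x: "\<And>i. i \<in> V \<Longrightarrow> x i > 0" "\<And>i. i \<notin> I \<Longrightarrow> x i = 1" for x
    proof -
      define R where "R = (\<Prod>i\<in>I-{j}. x i ^ \<kappa> i)"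
      have "R \<ge> 0" unfolding R_def
        using x(1) Suc(4) by (intro prod_nonneg) (auto intro!: zero_le_power less_imp_le)
      have "C * R * s ^ Suc n \<le> ev c \<alpha> (x(j := s))" if "s > 0" for s
      proof -
        have "C * (\<Prod>i\<in>I. (x(j := s)) i ^ \<kappa> i) \<le> ev c \<alpha> (x(j := s))"
          using that x j by (intro Suc(6)) auto
        moreover have "(\<Prod>i\<in>I-{j}. (x(j := s)) i ^ \<kappa> i) = R"
          unfolding R_def by (intro prod.cong) auto
        ultimately show ?thesis unfolding split using n by (simp add: mult_ac)
      qed
      from ev_pd_ge[OF Suc(3) jV x(1) _ this] \<open>R \<ge> 0\<close> C
      have "C * R * g * x j ^ n \<le> ev (pdc j c \<alpha>) (pde j \<alpha>) x" by (simp add: g_def del: power_Suc)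
      moreover have "(\<Prod>i\<in>I. x i ^ \<kappa>' i) = x j ^ n * R"
        unfolding split rest R_def by (simp add: \<kappa>'_def)
      ultimately show ?thesis by (simp add: mult_ac)
    qed
    have st: "stable (pdc j c \<alpha>) (pde j \<alpha>)"
    proof -
      have "ev (pdc j c \<alpha>) (pde j \<alpha>) (\<lambda>_. 1) > (0::real)"
      proof (rule less_le_trans)
        show "0 < C * g" using C g by simp
        show "C * g \<le> ev (pdc j c \<alpha>) (pde j \<alpha>) (\<lambda>_. 1)" using le[of "\<lambda>_. 1"] by simp
      qed
      then obtain k where "k \<in> K" "pdc j c \<alpha> k \<noteq> 0" unfolding ev_def
        by (metis (no_types, lifting) less_irrefl mult_zero_left of_real_0 sum.neutral)
      then show ?thesis using stable_nonneg[OF Suc(3), of k] by (intro stable_pd[OF Suc(3) jV, of k]) auto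
    qed
    have N: "N = (\<Sum>i\<in>I. \<kappa>' i)"
    proof -
      have "(\<Sum>i\<in>I-{j}. \<kappa>' i) = (\<Sum>i\<in>I-{j}. \<kappa> i)" by (intro sum.cong) (auto simp: \<kappa>'_def)
      then show ?thesis
        using Suc(2) n finI j(1) by (simp add: sum.remove[of I j] \<kappa>'_def)
    qed
    have "C * g * (\<Prod>i\<in>I. real (\<kappa>' i) ^ \<kappa>' i * exp (- real (\<kappa>' i)) / fact (\<kappa>' i)) \<le>
        (\<Sum>k | k \<in> K \<and> (\<forall>i\<in>I. pde j \<alpha> k i = \<kappa>' i). pdc j c \<alpha> k)"
      using C g by (intro Suc(1)[OF N st Suc(4) _ le]) auto
    also have "\<dots> = (\<Sum>k | k \<in> K \<and> (\<forall>i\<in>I. \<alpha> k i = \<kappa> i). pdc j c \<alpha> k)"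
    \<comment> \<open>Truncated subtraction can let an index with exponent 0 at \<open>j\<close>
      match \<open>\<kappa>'\<close> when n = 0; such indices have coefficient 0 after
      differentiation.\<close>
    proof (rule sum.mono_neutral_right)
      show "{k \<in> K. \<forall>i\<in>I. \<alpha> k i = \<kappa> i} \<subseteq> {k \<in> K. \<forall>i\<in>I. pde j \<alpha> k i = \<kappa>' i}"
        by (auto simp: \<kappa>'_def n)
      show "\<forall>k\<in>{k \<in> K. \<forall>i\<in>I. pde j \<alpha> k i = \<kappa>' i} - {k \<in> K. \<forall>i\<in>I. \<alpha> k i = \<kappa> i}. pdc j c \<alpha> k = 0"
      proof
        fix k assume k: "k \<in> {k \<in> K. \<forall>i\<in>I. pde j \<alpha> k i = \<kappa>' i} - {k \<in> K. \<forall>i\<in>I. \<alpha> k i = \<kappa> i}"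
        then obtain i where i: "i \<in> I" "\<alpha> k i \<noteq> \<kappa> i" by auto
        have "i = j"
        proof (rule ccontr)
          assume "i \<noteq> j"
          moreover have "pde j \<alpha> k i = \<kappa>' i" using k i by blast
          ultimately show False using i by (simp add: \<kappa>'_def)
        qed
        moreover have "pde j \<alpha> k j = \<kappa>' j" using k j by blast
        ultimately have "\<alpha> k j = 0" using i n by (simp add: \<kappa>'_def)
        then show "pdc j c \<alpha> k = 0" by simp
      qed
    qed (use fin in auto)
    also have "\<dots> = real (Suc n) * (\<Sum>k | k \<in> K \<and> (\<forall>i\<in>I. \<alpha> k i = \<kappa> i). c k)"
      unfolding sum_distrib_left using j n by (intro sum.cong) auto
    finally have *: "C * g * (\<Prod>i\<in>I. real (\<kappa>' i) ^ \<kappa>' i * exp (- real (\<kappa>' i)) / fact (\<kappa>' i)) \<le>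
      real (Suc n) * (\<Sum>k | k \<in> K \<and> (\<forall>i\<in>I. \<alpha> k i = \<kappa> i). c k)" .
    \<comment> \<open>One step of the telescoping; \<open>real (Suc n)\<close> is the exponent
      brought down by the derivative. For n = 0 the convention 0^0 = 1 enters.\<close>
    have "g * (real n ^ n * exp (- real n) / fact n) =
      real (Suc n) * (real (Suc n) ^ Suc n * exp (- real (Suc n)) / fact (Suc n))"
    proof -
      have "exp (- real (Suc n)) = exp (- real n) / exp 1"
        by (simp flip: exp_diff)
      then show ?thesis using npos by (simp add: g_def field_simps del: power_Suc of_nat_Suc)
    qed
    then have "C * g * (\<Prod>i\<in>I. real (\<kappa>' i) ^ \<kappa>' i * exp (- real (\<kappa>' i)) / fact (\<kappa>' i)) =
      real (Suc n) * (C * (\<Prod>i\<in>I. real (\<kappa> i) ^ \<kappa> i * exp (- real (\<kappa> i)) / fact (\<kappa> i)))"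
    proof -
      assume *: "g * (real n ^ n * exp (- real n) / fact n) =
        real (Suc n) * (real (Suc n) ^ Suc n * exp (- real (Suc n)) / fact (Suc n))"
      have "\<kappa>' j = n" by (simp add: \<kappa>'_def)
      then show ?thesis
        unfolding split rest[of "\<lambda>_ m. real m ^ m * exp (- real m) / fact m"] n
        using arg_cong[OF *, of "\<lambda>z. C * z * (\<Prod>i\<in>I - {j}. real (\<kappa> i) ^ \<kappa> i * exp (- real (\<kappa> i)) / fact (\<kappa> i))"]
        by (simp only: mult.assoc) (simp only: mult.left_commute)
    qed
    with * show ?thesis by simp
  qed
qed

end

section \<open>Capacity from means\<close>

text \<open>The chord of the exponential through 0 and 1 lies below it at all integers, though not
  strictly between 0 and 1. This is where integrality of the counts enters.\<close>

lemma exp_mult_ge_int: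
  fixes d :: real and j :: int
  assumes "d \<ge> 0"
  shows "exp (d * of_int j) \<ge> 1 + of_int j * (exp d - 1)"
proof (cases "j \<ge> 0")
  case True
  then obtain n where n: "j = int n" using nonneg_int_cases by blast
  have "(1 + (exp d - 1)) ^ n \<ge> 1 + real n * (exp d - 1)"
    using exp_gt_zero[of d] by (intro Bernoulli_inequality) linarith
  then show ?thesis by (simp add: n exp_of_nat2_mult)
next
  case False
  define n where "n = nat (- j)"
  have n: "of_int j = - real n" using False by (simp add: n_def)
  have "(1 + (exp (- d) - 1)) ^ n \<ge> 1 + real n * (exp (- d) - 1)"
    using exp_gt_zero[of "- d"] by (intro Bernoulli_inequality) linarith
  moreover have "exp (- d) - 1 \<ge> - (exp d - 1)"
    using exp_ge_add_one_self[of d] exp_ge_add_one_self[of "- d"] by linarith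
  then have "real n * (exp (- d) - 1) \<ge> real n * - (exp d - 1)"
    by (intro mult_left_mono) auto
  moreover have "(1 + (exp (- d) - 1)) ^ n = exp (d * of_int j)"
    by (simp add: n flip: exp_of_nat2_mult)
  ultimately show ?thesis by (simp add: n algebra_simps)
qed

text \<open>Equality at k = 1; the induction step amounts to (x + 1/2) ln (1 + 1/x) \<ge> 1, which
  is the midpoint bound for the integral of 1/t over [x, x + 1].\<close>

lemma fact_le_Stirling:
  assumes "k \<ge> 1"
  shows "fact k \<le> exp 1 * sqrt (real k) * (real k ^ k * exp (- real k))"
  using assms
proof (induction k rule: dec_induct)
  case base
  then show ?case by (simp flip: exp_add)
next
  case (step k)
  define x where "x = real k"
  have x: "x \<ge> 1" using step by (simp add: x_def)
  have "2 / (2 * x + 1) \<le> ln (x + 1) - ln x"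
    using ln_inverse_approx_ge[of x "x + 1"] x by (simp add: add_ac)
  then have "1 \<le> (x + 1 / 2) * (ln (x + 1) - ln x)"
    using x by (simp add: field_simps)
  then have "ln x / 2 + x * ln x + 1 \<le> ln (x + 1) / 2 + x * ln (x + 1)"
    by (simp add: algebra_simps)
  then have "exp (ln x / 2 + x * ln x + 1) \<le> exp (ln (x + 1) / 2 + x * ln (x + 1))" by simp
  moreover have "exp (ln y / 2) = sqrt y" "exp (x * ln y) = y ^ k" if "y > 0" for y
    using that by (simp_all add: powr_half_sqrt powr_def x_def flip: powr_realpow)
      (simp add: powr_half_sqrt[symmetric] powr_def)
  ultimately have le: "sqrt x * x ^ k * exp 1 \<le> sqrt (x + 1) * (x + 1) ^ k"
    using x by (simp add: exp_add)
  have "fact (Suc k) = (x + 1) * fact k" by (simp add: x_def)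
  also have "\<dots> \<le> (x + 1) * (exp 1 * sqrt x * (x ^ k * exp (- x)))"
    using step x unfolding x_def by (intro mult_left_mono) auto
  also have "\<dots> = (x + 1) * exp (- x) * (sqrt x * x ^ k * exp 1)" by (simp add: mult_ac)
  also have "\<dots> \<le> (x + 1) * exp (- x) * (sqrt (x + 1) * (x + 1) ^ k)"
    using le x by (intro mult_left_mono) auto
  also have "\<dots> = exp 1 * sqrt (x + 1) * ((x + 1) ^ Suc k * exp (- (x + 1)))"
    by (simp add: mult_ac exp_add flip: exp_diff) (simp add: exp_diff exp_minus field_simps)
  finally show ?case by (simp add: x_def add_ac)
qed

section \<open>Exponential tilts and their effect on means\<close>

context nonneg_poly
begin

text \<open>
  In the logarithmic coordinates \<open>x = exp u\<close>, \<open>wsum c \<alpha> u f\<close> is the unnormalised expectation of \<open>f\<close>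
  under the exponential tilt of \<open>c\<close> by \<open>u\<close>.
\<close>

definition wsum :: "('k \<Rightarrow> real) \<Rightarrow> ('k \<Rightarrow> 'v \<Rightarrow> nat) \<Rightarrow> ('v \<Rightarrow> real) \<Rightarrow> ('k \<Rightarrow> real) \<Rightarrow> real" where
  "wsum c \<alpha> u f = mean c \<alpha> (\<lambda>i. exp (u i)) f"

text \<open>The random variable \<open>A\<^sub>S\<close>, read off from the exponents.\<close>

definition deg :: "('k \<Rightarrow> 'v \<Rightarrow> nat) \<Rightarrow> 'v set \<Rightarrow> 'k \<Rightarrow> real" where
  "deg \<alpha> S k = (\<Sum>i\<in>S. real (\<alpha> k i))"

definition shift :: "('v \<Rightarrow> real) \<Rightarrow> 'v set \<Rightarrow> real \<Rightarrow> 'v \<Rightarrow> real" where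
  "shift u S t = (\<lambda>i. u i + (if i \<in> S then t else 0))"

lemma wsum_eq: "wsum c \<alpha> u f = (\<Sum>k\<in>K. c k * exp (\<Sum>i\<in>V. u i * real (\<alpha> k i)) * f k)"
  unfolding wsum_def mean_def ev_def exp_sum[OF fin(1)]
  by (simp add: mult_ac flip: exp_of_nat2_mult)

text \<open>Shifting the logarithmic coordinates in \<open>S\<close> by t reweights by
  \<open>exp (t * deg \<alpha> S k)\<close>. Differentiating in t therefore inserts a factor
  \<open>deg \<alpha> S\<close>.\<close>

lemma wsum_shift:
  assumes "S \<subseteq> V"
  shows "wsum c \<alpha> (shift u S t) f = wsum c \<alpha> u (\<lambda>k. f k * exp (t * deg \<alpha> S k))"
proof -
  have "(\<Sum>i\<in>V. shift u S t i * real (\<alpha> k i)) = (\<Sum>i\<in>V. u i * real (\<alpha> k i)) + t * deg \<alpha> S k" for k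
  proof -
    have "(\<Sum>i\<in>V. shift u S t i * real (\<alpha> k i)) =
      (\<Sum>i\<in>V. u i * real (\<alpha> k i) + (if i \<in> S then t * real (\<alpha> k i) else 0))"
      by (intro sum.cong) (auto simp: shift_def algebra_simps)
    also have "\<dots> = (\<Sum>i\<in>V. u i * real (\<alpha> k i)) + (\<Sum>i\<in>V\<inter>S. t * real (\<alpha> k i))"
      using fin by (simp add: sum.distrib sum.inter_restrict)
    also have "V \<inter> S = S" using assms by auto
    finally show ?thesis by (simp add: deg_def sum_distrib_left)
  qed
  then show ?thesis by (simp add: wsum_eq exp_add mult_ac)
qed

lemma wsum_one: "wsum c \<alpha> u (\<lambda>_. 1) = ev c \<alpha> (\<lambda>i. exp (u i))"
  by (simp add: wsum_def mean_def)

lemma wsum_one_pos: "stable c \<alpha> \<Longrightarrow> wsum c \<alpha> u (\<lambda>_. 1) > 0"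
  unfolding wsum_one by (rule stable_pos) auto

lemma wsum_linear:
  "wsum c \<alpha> u (\<lambda>k. a * f k + b * g k) = a * wsum c \<alpha> u f + b * wsum c \<alpha> u g"
  by (simp add: wsum_eq sum_distrib_left algebra_simps sum.distrib)

lemma wsum_mono:
  assumes "\<And>k. k \<in> K \<Longrightarrow> c k \<ge> 0" "\<And>k. k \<in> K \<Longrightarrow> f k \<le> g k"
  shows "wsum c \<alpha> u f \<le> wsum c \<alpha> u g"
  unfolding wsum_eq using assms by (intro sum_mono mult_left_mono) auto

lemma cov_deg:
  "wsum c \<alpha> u (\<lambda>k. deg \<alpha> T k * deg \<alpha> S k) * wsum c \<alpha> u (\<lambda>_. 1) - wsum c \<alpha> u (deg \<alpha> T) * wsum c \<alpha> u (deg \<alpha> S)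
   = (\<Sum>i\<in>T. \<Sum>j\<in>S. cov c \<alpha> (\<lambda>i. exp (u i)) i j)"
proof -
  have sum1: "wsum c \<alpha> u (\<lambda>k. \<Sum>i\<in>T. f i k) = (\<Sum>i\<in>T. wsum c \<alpha> u (f i))" for f :: "'v \<Rightarrow> 'k \<Rightarrow> real" and T
    unfolding wsum_eq sum_distrib_left by (rule sum.swap)
  have 1: "wsum c \<alpha> u (\<lambda>k. deg \<alpha> T k * deg \<alpha> S k) = (\<Sum>i\<in>T. \<Sum>j\<in>S. wsum c \<alpha> u (\<lambda>k. real (\<alpha> k i) * real (\<alpha> k j)))"
    unfolding deg_def sum_product sum1 ..
  have deg: "wsum c \<alpha> u (deg \<alpha> T) = (\<Sum>i\<in>T. wsum c \<alpha> u (\<lambda>k. real (\<alpha> k i)))" for T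
    unfolding deg_def[abs_def] sum1 ..
  have 2: "wsum c \<alpha> u (deg \<alpha> T) * wsum c \<alpha> u (deg \<alpha> S) =
      (\<Sum>i\<in>T. \<Sum>j\<in>S. wsum c \<alpha> u (\<lambda>k. real (\<alpha> k i)) * wsum c \<alpha> u (\<lambda>k. real (\<alpha> k j)))"
    unfolding deg by (rule sum_product)
  have "cov c \<alpha> (\<lambda>i. exp (u i)) i j = wsum c \<alpha> u (\<lambda>k. real (\<alpha> k i) * real (\<alpha> k j)) * wsum c \<alpha> u (\<lambda>_. 1)
      - wsum c \<alpha> u (\<lambda>k. real (\<alpha> k i)) * wsum c \<alpha> u (\<lambda>k. real (\<alpha> k j))" for i j
    unfolding wsum_one by (simp add: cov_def wsum_def)
  then show ?thesis by (simp only: 1 2 sum_subtractf sum_distrib_right)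
qed

lemma cov_deg_subset:
  assumes "stable c \<alpha>" "T \<subseteq> S" "S \<subseteq> V"
  shows "wsum c \<alpha> u (deg \<alpha> T) * wsum c \<alpha> u (deg \<alpha> S) \<le> wsum c \<alpha> u (\<lambda>k. deg \<alpha> T k * deg \<alpha> S k) * wsum c \<alpha> u (\<lambda>_. 1)"
proof -
  have "(\<Sum>i\<in>T. \<Sum>j\<in>S. cov c \<alpha> (\<lambda>i. exp (u i)) i j) \<ge> 0"
    using assms by (intro sum_nonneg cov_sum_nonneg) auto
  then show ?thesis using cov_deg[of c \<alpha> u T S] by simp
qed

lemma cov_deg_disjoint:
  assumes "stable c \<alpha>" "T \<inter> S = {}" "T \<subseteq> V" "S \<subseteq> V"
  shows "wsum c \<alpha> u (\<lambda>k. deg \<alpha> T k * deg \<alpha> S k) * wsum c \<alpha> u (\<lambda>_. 1) \<le> wsum c \<alpha> u (deg \<alpha> T) * wsum c \<alpha> u (deg \<alpha> S)"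
proof -
  have "cov c \<alpha> (\<lambda>i. exp (u i)) i j \<le> 0" if "i \<in> T" "j \<in> S" for i j
  proof -
    have "i \<noteq> j" "i \<in> V" "j \<in> V" using assms that by auto
    then show ?thesis using cov_le[OF assms(1), of i j "\<lambda>i. exp (u i)"] by simp
  qed
  then have "(\<Sum>i\<in>T. \<Sum>j\<in>S. cov c \<alpha> (\<lambda>i. exp (u i)) i j) \<le> 0"
    by (intro sum_nonpos) auto
  then show ?thesis using cov_deg[of c \<alpha> u T S] by simp
qed

definition avg :: "('k \<Rightarrow> real) \<Rightarrow> ('k \<Rightarrow> 'v \<Rightarrow> nat) \<Rightarrow> ('v \<Rightarrow> real) \<Rightarrow> 'v set \<Rightarrow> real" where
  "avg c \<alpha> u T = wsum c \<alpha> u (deg \<alpha> T) / wsum c \<alpha> u (\<lambda>_. 1)"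

text \<open>The t-derivative of the tilted mean of \<open>deg \<alpha> T\<close> is \<open>s\<close>
  times its covariance with \<open>deg \<alpha> S\<close>: nonnegative covariance for T \<subseteq>
  S, nonpositive for disjoint sets. The sign \<open>r\<close> tells which side of the mean is being
  controlled, and r s matches the sign of the covariance.\<close>

lemma avg_shift:
  assumes st: "stable c \<alpha>" and S: "S \<subseteq> V" and T: "T \<subseteq> V" and "t \<ge> 0"
    and "s = 1 \<or> s = -1"
    and "r = s \<and> T \<subseteq> S \<or> r = - s \<and> T \<inter> S = {}"
  shows "r * avg c \<alpha> u T \<le> r * avg c \<alpha> (shift u S (s * t)) T"
proof -
  define W where "W = (\<lambda>f t. wsum c \<alpha> (shift u S (s * t)) f)"
  have dW: "((\<lambda>t. W f t) has_real_derivative W (\<lambda>k. f k * deg \<alpha> S k) t * s) (at t)" for f t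
    unfolding W_def wsum_shift[OF S] unfolding wsum_eq
    by (auto intro!: derivative_eq_intros sum.cong simp: sum_distrib_left mult_ac)
  have pos: "W (\<lambda>_. 1) t > 0" for t unfolding W_def by (rule wsum_one_pos[OF st])
  have avg: "avg c \<alpha> (shift u S (s * t)) T = W (deg \<alpha> T) t / W (\<lambda>_. 1) t" for t
    by (simp add: avg_def W_def)
  have deriv: "((\<lambda>t. r * (W (deg \<alpha> T) t / W (\<lambda>_. 1) t)) has_real_derivative
      r * s * (W (\<lambda>k. deg \<alpha> T k * deg \<alpha> S k) t * W (\<lambda>_. 1) t - W (deg \<alpha> T) t * W (deg \<alpha> S) t) / (W (\<lambda>_. 1) t) ^ 2) (at t)" for t
    using pos[of t]
    by (auto intro!: derivative_eq_intros dW simp: power2_eq_square algebra_simps)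
  have nonneg: "r * s * (W (\<lambda>k. deg \<alpha> T k * deg \<alpha> S k) t * W (\<lambda>_. 1) t - W (deg \<alpha> T) t * W (deg \<alpha> S) t) / (W (\<lambda>_. 1) t) ^ 2 \<ge> 0" for t
    using assms(6)
  proof
    assume "r = s \<and> T \<subseteq> S"
    then have "r * s = 1" "T \<subseteq> S" using assms(5) by auto
    then show ?thesis using cov_deg_subset[OF st _ S, of T "shift u S (s * t)"] by (simp add: W_def)
  next
    assume "r = - s \<and> T \<inter> S = {}"
    then have "r * s = -1" "T \<inter> S = {}" using assms(5) by auto
    then show ?thesis using cov_deg_disjoint[OF st _ T S, of "shift u S (s * t)"] by (simp add: W_def)
  qed
  have "r * (W (deg \<alpha> T) 0 / W (\<lambda>_. 1) 0) \<le> r * (W (deg \<alpha> T) t / W (\<lambda>_. 1) t)"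
    using \<open>t \<ge> 0\<close> by (rule DERIV_nonneg_imp_nondecreasing) (use deriv nonneg in blast)
  moreover have "shift u S (s * 0) = u" by (simp add: shift_def)
  ultimately show ?thesis unfolding avg[symmetric] by simp
qed

text \<open>Let Z be \<open>s\<close> times the deviation of \<open>deg \<alpha> S\<close> from its
  target. Applying \<open>exp_mult_ge_int\<close> to the integer Z + 1, whose mean is at least e,
  bounds the mean of exp (t (Z + 1)) below by 1 + e (exp t - 1) \<ge> e exp t; then exp t
  cancels.\<close>

lemma wsum_one_shift_ge:
  fixes \<kappa> :: "'v \<Rightarrow> nat"
  assumes st: "stable c \<alpha>" and S: "S \<subseteq> V" and "t \<ge> 0" and s: "s = 1 \<or> s = -1" and e: "0 < e" "e \<le> 1"
    and avg: "s * (avg c \<alpha> u S - (\<Sum>i\<in>S. real (\<kappa> i))) \<ge> e - 1"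
  shows "e * exp (s * t * (\<Sum>i\<in>S. real (\<kappa> i))) * wsum c \<alpha> u (\<lambda>_. 1) \<le> wsum c \<alpha> (shift u S (s * t)) (\<lambda>_. 1)"
proof -
  define q where "q = (\<Sum>i\<in>S. real (\<kappa> i))"
  define Z where "Z = wsum c \<alpha> u (\<lambda>_. 1)"
  have Z: "Z > 0" unfolding Z_def by (rule wsum_one_pos[OF st])
  have wS: "s * (wsum c \<alpha> u (deg \<alpha> S) - q * Z) \<ge> (e - 1) * Z"
  proof -
    have "wsum c \<alpha> u (deg \<alpha> S) = avg c \<alpha> u S * Z" using Z by (simp add: avg_def Z_def)
    then have "s * (wsum c \<alpha> u (deg \<alpha> S) - q * Z) = s * (avg c \<alpha> u S - q) * Z"
      by (simp only: left_diff_distrib right_diff_distrib mult.assoc)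
    then show ?thesis using mult_right_mono[OF avg[folded q_def], of Z] Z by linarith
  qed
  have "exp (s * t * deg \<alpha> S k) \<ge> exp (s * t * q) * exp (- t) * (1 + (s * (deg \<alpha> S k - q) + 1) * (exp t - 1))" for k
  proof -
    obtain j :: int where j: "of_int j = s * (deg \<alpha> S k - q) + 1"
    proof -
      have "s * (deg \<alpha> S k - q) + 1 \<in> \<int>" using s
        by (auto simp: deg_def q_def intro!: Ints_diff simp flip: of_nat_sum)
      then show ?thesis using that by (metis Ints_cases)
    qed
    have "exp (s * t * deg \<alpha> S k) = exp (s * t * q) * exp (- t) * exp (t * of_int j)"
      by (simp add: j flip: exp_add) (simp add: algebra_simps)
    then show ?thesis
      using mult_left_mono[OF exp_mult_ge_int[OF \<open>t \<ge> 0\<close>, of j], of "exp (s * t * q) * exp (- t)"]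
      by (simp add: j)
  qed
  then have "wsum c \<alpha> u (\<lambda>k. exp (s * t * q) * exp (- t) * (1 + (s * (deg \<alpha> S k - q) + 1) * (exp t - 1)))
      \<le> wsum c \<alpha> u (\<lambda>k. exp (s * t * deg \<alpha> S k))"
    using stable_nonneg[OF st] by (intro wsum_mono)
  also have "\<dots> = wsum c \<alpha> (shift u S (s * t)) (\<lambda>_. 1)" by (simp add: wsum_shift[OF S])
  finally have 1: "wsum c \<alpha> u (\<lambda>k. exp (s * t * q) * exp (- t) * (1 + (s * (deg \<alpha> S k - q) + 1) * (exp t - 1)))
      \<le> wsum c \<alpha> (shift u S (s * t)) (\<lambda>_. 1)" .
  have "wsum c \<alpha> u (\<lambda>k. exp (s * t * q) * exp (- t) * (1 + (s * (deg \<alpha> S k - q) + 1) * (exp t - 1))) =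
    wsum c \<alpha> u (\<lambda>k. (exp (s * t * q) * exp (- t) * (1 + (1 - s * q) * (exp t - 1))) * 1
       + (exp (s * t * q) * exp (- t) * s * (exp t - 1)) * deg \<alpha> S k)"
    by (rule arg_cong[of _ _ "wsum c \<alpha> u"]) (auto simp: algebra_simps)
  also have "\<dots> = exp (s * t * q) * exp (- t) * (Z + (s * (wsum c \<alpha> u (deg \<alpha> S) - q * Z) + Z) * (exp t - 1))"
    unfolding wsum_linear Z_def by (simp add: algebra_simps)
  also have "\<dots> \<ge> exp (s * t * q) * exp (- t) * (Z + ((e - 1) * Z + Z) * (exp t - 1))"
    using wS \<open>t \<ge> 0\<close> by (intro mult_left_mono add_left_mono mult_right_mono add_right_mono) auto
  also have "exp (s * t * q) * exp (- t) * (Z + ((e - 1) * Z + Z) * (exp t - 1)) =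
      exp (s * t * q) * exp (- t) * (Z * (1 - e) + Z * e * exp t)"
    by (simp add: algebra_simps)
  also have "\<dots> \<ge> exp (s * t * q) * exp (- t) * (Z * e * exp t)"
    using Z e by (intro mult_left_mono) auto
  also have "exp (s * t * q) * exp (- t) * (Z * e * exp t) = e * exp (s * t * q) * Z"
    by (simp add: exp_minus field_simps)
  finally show ?thesis using 1 by (simp add: Z_def q_def)
qed

text \<open>The logarithmic point \<open>u\<close> moves to \<open>u + y\<close> along the level sets of \<open>y\<close>: each move shifts the
  coordinates where \<open>y\<close> has a fixed sign towards their target until one of them arrives. By the
  covariance inequalities no move can spoil the bounds on means needed by the later moves.\<close>

lemma capacity_log:
  fixes \<kappa> :: "'v \<Rightarrow> nat"
  assumes st: "stable c \<alpha>" and e: "0 < e" "e \<le> 1" and I: "I \<subseteq> V"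
    and "\<And>i. i \<notin> I \<Longrightarrow> y i = 0"
    and "\<And>s T. s = 1 \<or> s = -1 \<Longrightarrow> T \<subseteq> {i. s * y i > 0} \<Longrightarrow> s * (avg c \<alpha> u T - (\<Sum>i\<in>T. real (\<kappa> i))) \<ge> e - 1"
  shows "e ^ card {i. y i \<noteq> 0} * exp (\<Sum>i\<in>I. y i * real (\<kappa> i)) * wsum c \<alpha> u (\<lambda>_. 1)
     \<le> wsum c \<alpha> (\<lambda>i. u i + y i) (\<lambda>_. 1)"
  using assms(5,6)
proof (induction "card {i. y i \<noteq> 0}" arbitrary: u y rule: less_induct)
  case less
  have finI: "finite I" using I fin finite_subset by blast
  have supp: "{i. y i \<noteq> 0} \<subseteq> I" using less(2) by auto
  then have fsupp: "finite {i. y i \<noteq> 0}" using finI finite_subset by blast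
  show ?case
  proof (cases "\<forall>i. y i = 0")
    case False
    then obtain a where a: "y a \<noteq> 0" by blast
    define s :: real where "s = sgn (y a)"
    have s: "s = 1 \<or> s = -1" using a by (auto simp: s_def sgn_if)
    then have ss: "s * s = 1" by auto
    define S where "S = {i. s * y i > 0}"
    have aS: "a \<in> S" using a by (auto simp: S_def s_def sgn_if)
    have SI: "S \<subseteq> I" using supp by (auto simp: S_def)
    then have finS: "finite S" using finI finite_subset by blast
    \<comment> \<open>The largest common move that overshoots no target in \<open>S\<close>; some
      coordinate \<open>b\<close> arrives, so the support of the remaining displacement
      shrinks.\<close>
    define t where "t = Min ((\<lambda>i. s * y i) ` S)"
    have "t \<in> (\<lambda>i. s * y i) ` S" unfolding t_def using finS aS by (intro Min_in) auto
    then obtain b where b: "b \<in> S" "t = s * y b" by auto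
    have t: "t > 0" using b by (simp add: S_def)
    have tmin: "t \<le> s * y i" if "i \<in> S" for i
      unfolding t_def using that finS by (intro Min_le) auto
    define y' where "y' = shift y S (- (s * t))"
    define u' where "u' = shift u S (s * t)"
    have y'b: "y' b = 0" using b ss by (simp add: y'_def shift_def mult.assoc[symmetric])
    have sub: "{i. y' i \<noteq> 0} \<subseteq> {i. y i \<noteq> 0}" by (auto simp: y'_def shift_def S_def split: if_splits)
    have "b \<in> {i. y i \<noteq> 0}" using b t by auto
    then have "{i. y' i \<noteq> 0} \<subset> {i. y i \<noteq> 0}" using sub y'b by auto
    then have card: "card {i. y' i \<noteq> 0} < card {i. y i \<noteq> 0}" using fsupp psubset_card_mono by blast
    \<comment> \<open>A coordinate still to move in direction \<open>s\<close> and involved in the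
      current move stays in \<open>S\<close>; one to move in the opposite direction was never in
      \<open>S\<close>. This is the dichotomy required by \<open>avg_shift\<close>.\<close>
    have y'pos: "(if r = s then T \<subseteq> S else T \<inter> S = {}) \<and> T \<subseteq> {i. r * y i > 0}"
      if r: "r = 1 \<or> r = -1" and T: "T \<subseteq> {i. r * y' i > 0}" for r T
    proof -
      have "(if r = s then i \<in> S else i \<notin> S) \<and> r * y i > 0" if "i \<in> T" for i
      proof -
        have i: "r * y' i > 0" using that T by auto
        show ?thesis
        proof (cases "i \<in> S")
          case True
          have "r = s"
          proof (rule ccontr)
            assume "r \<noteq> s"
            then have "r = - s" using r s by auto
            then have "- (s * y i) + s * s * t > 0" using i True by (simp add: y'_def shift_def algebra_simps)
            then have "- (s * y i) + t > 0" unfolding ss by simp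
            then show False using tmin[OF True] by simp
          qed
          then show ?thesis using True by (simp add: S_def)
        next
          case False
          then have "r * y i > 0" using i by (simp add: y'_def shift_def)
          then show ?thesis using False by (auto simp: S_def)
        qed
      qed
      then show ?thesis by auto
    qed
    have avg': "r * (avg c \<alpha> u' T - (\<Sum>i\<in>T. real (\<kappa> i))) \<ge> e - 1"
      if r: "r = 1 \<or> r = -1" and T: "T \<subseteq> {i. r * y' i > 0}" for r T
    proof -
      note T' = y'pos[OF r T]
      have "T \<subseteq> {i. r * y i > 0}" using T' by blast
      also have "\<dots> \<subseteq> I" using supp by auto
      finally have "T \<subseteq> I" .
      have "r * avg c \<alpha> u T \<le> r * avg c \<alpha> u' T" unfolding u'_def
        using T' r s t \<open>T \<subseteq> I\<close> I SI by (intro avg_shift[OF st]) (auto split: if_splits)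
      then show ?thesis using less(3)[OF r, of T] T' by (simp add: right_diff_distrib)
    qed
    have IH: "e ^ card {i. y' i \<noteq> 0} * exp (\<Sum>i\<in>I. y' i * real (\<kappa> i)) * wsum c \<alpha> u' (\<lambda>_. 1)
        \<le> wsum c \<alpha> (\<lambda>i. u' i + y' i) (\<lambda>_. 1)"
      using less(2) SI by (intro less(1)[OF card _ avg']) (auto simp: y'_def shift_def)
    have step: "e * exp (s * t * (\<Sum>i\<in>S. real (\<kappa> i))) * wsum c \<alpha> u (\<lambda>_. 1) \<le> wsum c \<alpha> u' (\<lambda>_. 1)"
      unfolding u'_def using t e s I SI less(3)[OF s, of S]
      by (intro wsum_one_shift_ge[OF st]) (auto simp: S_def)
    have uy: "(\<lambda>i. u' i + y' i) = (\<lambda>i. u i + y i)"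
      by (auto simp: u'_def y'_def shift_def)
    have expo: "(\<Sum>i\<in>I. y i * real (\<kappa> i)) = (\<Sum>i\<in>I. y' i * real (\<kappa> i)) + s * t * (\<Sum>i\<in>S. real (\<kappa> i))"
    proof -
      have "(\<Sum>i\<in>I. y i * real (\<kappa> i)) = (\<Sum>i\<in>I. y' i * real (\<kappa> i) + (if i \<in> S then s * t * real (\<kappa> i) else 0))"
        by (intro sum.cong) (auto simp: y'_def shift_def algebra_simps)
      also have "\<dots> = (\<Sum>i\<in>I. y' i * real (\<kappa> i)) + (\<Sum>i\<in>I\<inter>S. s * t * real (\<kappa> i))"
        using finI by (simp add: sum.distrib sum.inter_restrict)
      also have "I \<inter> S = S" using SI by auto
      finally show ?thesis by (simp add: sum_distrib_left)
    qed
    have "e ^ card {i. y i \<noteq> 0} * exp (\<Sum>i\<in>I. y i * real (\<kappa> i)) * wsum c \<alpha> u (\<lambda>_. 1)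
      \<le> e ^ Suc (card {i. y' i \<noteq> 0}) * exp (\<Sum>i\<in>I. y i * real (\<kappa> i)) * wsum c \<alpha> u (\<lambda>_. 1)"
      using card e wsum_one_pos[OF st, of u]
      by (intro mult_right_mono power_decreasing) (auto intro: less_imp_le)
    also have "\<dots> = (e ^ card {i. y' i \<noteq> 0} * exp (\<Sum>i\<in>I. y' i * real (\<kappa> i))) *
        (e * exp (s * t * (\<Sum>i\<in>S. real (\<kappa> i))) * wsum c \<alpha> u (\<lambda>_. 1))"
      unfolding expo exp_add by (simp add: mult_ac)
    also have "\<dots> \<le> (e ^ card {i. y' i \<noteq> 0} * exp (\<Sum>i\<in>I. y' i * real (\<kappa> i))) * wsum c \<alpha> u' (\<lambda>_. 1)"
      using e by (intro mult_left_mono step) auto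
    also note IH
    finally show ?thesis unfolding uy .
  qed simp
qed

end

section \<open>Strongly Rayleigh distributions\<close>

lemma strongly_Rayleigh_lower_bound:
  fixes n :: nat and \<kappa> :: "nat \<Rightarrow> nat"
  assumes sr: "strongly_rayleigh m \<mu>" and D: "disjoint_subsets m n D" and e: "\<epsilon> > 0"
    and close: "\<And>S. S \<subseteq> {1..n} \<Longrightarrow>
       \<bar>measure_pmf.expectation \<mu> (\<lambda>T. \<Sum>i\<in>S. real (count_in D i T)) - (\<Sum>i\<in>S. real (\<kappa> i))\<bar> \<le> 1 - \<epsilon>"
  shows "measure_pmf.prob \<mu> {T. \<forall>i\<in>{1..n}. count_in D i T = \<kappa> i}
     \<ge> \<epsilon> ^ n * (\<Prod>i\<in>{i\<in>{1..n}. \<kappa> i > 0}. 1 / (exp 1 * sqrt (real (\<kappa> i))))"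
proof -
  define K where "K = Pow {1..m}"
  interpret nonneg_poly "{0..n}" K by unfold_locales (auto simp: K_def)
  have supp: "set_pmf \<mu> \<subseteq> K" and gp: "\<And>z. (\<And>e. e \<in> {1..m} \<Longrightarrow> Im (z e) > 0) \<Longrightarrow> generating_poly m \<mu> z \<noteq> 0"
    using sr by (auto simp: strongly_rayleigh_def K_def)
  have Dm: "D i \<subseteq> {1..m}" if "i \<in> {1..n}" for i using D that by (auto simp: disjoint_subsets_def)
  have Ddisj: "i = j" if "i \<in> {1..n}" "j \<in> {1..n}" "a \<in> D i" "a \<in> D j" for i j a
    using D that unfolding disjoint_subsets_def disjoint_family_on_def by blast
  \<comment> \<open>Block 0 collects the elements outside all \<open>D i\<close>. It keeps its own
    variable, because fixing that variable at the real point 1 would leave the open upper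
    half-plane.\<close>
  define block where "block = (\<lambda>a. if \<exists>i\<in>{1..n}. a \<in> D i then SOME i. i \<in> {1..n} \<and> a \<in> D i else 0)"
  have block: "block a \<in> {1..n} \<and> a \<in> D (block a) \<or> block a = 0 \<and> (\<forall>i\<in>{1..n}. a \<notin> D i)" for a
    using someI_ex[of "\<lambda>i. i \<in> {1..n} \<and> a \<in> D i"] unfolding block_def by (smt (verit))
  have block_eq: "block a = i \<longleftrightarrow> a \<in> D i" if "i \<in> {1..n}" for a i
    using block[of a] Ddisj[of i "block a" a] that by auto
  define \<alpha> where "\<alpha> = (\<lambda>T i. card {a \<in> T. block a = i})"
  have \<alpha>: "\<alpha> T i = count_in D i T" if "i \<in> {1..n}" for T i
    using block_eq[OF that] by (auto simp: \<alpha>_def count_in_def intro!: arg_cong[of _ _ card])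
  \<comment> \<open>Identifying the variables within each block sends points of the upper
    half-planes to such points, so stability is inherited.\<close>
  have ev: "ev (pmf \<mu>) \<alpha> z = generating_poly m \<mu> (\<lambda>a. z (block a))" for z
    unfolding ev_def generating_poly_def K_def[symmetric]
  proof (intro sum.cong refl)
    fix T assume "T \<in> K"
    then have "finite T" by (auto simp: K_def intro: finite_subset)
    have "(\<Prod>i\<in>{0..n}. z i ^ \<alpha> T i) = (\<Prod>i\<in>{0..n}. \<Prod>a\<in>{a \<in> T. block a = i}. z (block a))"
      by (auto simp: \<alpha>_def intro!: prod.cong)
    also have "\<dots> = (\<Prod>a\<in>T. z (block a))"
      using block \<open>finite T\<close> by (intro prod.group) force+
    finally show "of_real (pmf \<mu> T) * (\<Prod>i\<in>{0..n}. z i ^ \<alpha> T i) = of_real (pmf \<mu> T) * (\<Prod>a\<in>T. z (block a))"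
      by simp
  qed
  have st: "stable (pmf \<mu>) \<alpha>"
    unfolding stable_def ev using block by (auto intro!: gp) (metis atLeastAtMost_iff zero_le)
  have expect: "measure_pmf.expectation \<mu> f = wsum (pmf \<mu>) \<alpha> (\<lambda>_. 0) f" for f
    using supp fin(2) by (subst integral_measure_pmf_real[of K]) (auto simp: wsum_eq mult_ac)
  have one: "wsum (pmf \<mu>) \<alpha> (\<lambda>_. 0) (\<lambda>_. 1) = 1"
    unfolding expect[symmetric] by simp
  have avg: "avg (pmf \<mu>) \<alpha> (\<lambda>_. 0) S = measure_pmf.expectation \<mu> (\<lambda>T. \<Sum>i\<in>S. real (count_in D i T))"
    if "S \<subseteq> {1..n}" for S
  proof -
    have "deg \<alpha> S T = (\<Sum>i\<in>S. real (count_in D i T))" for T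
      unfolding deg_def using that \<alpha> by (intro sum.cong) auto
    then show ?thesis unfolding avg_def one expect by (simp add: deg_def[abs_def])
  qed
  \<comment> \<open>The hypothesis for the empty set already forces \<epsilon> \<le> 1.\<close>
  have e1: "\<epsilon> \<le> 1" using close[of "{}"] by simp
  have cap: "\<epsilon> ^ n * (\<Prod>i\<in>{1..n}. x i ^ \<kappa> i) \<le> ev (pmf \<mu>) \<alpha> x"
    if x: "\<And>i. i \<in> {0..n} \<Longrightarrow> x i > 0" "\<And>i. i \<notin> {1..n} \<Longrightarrow> x i = 1" for x
  proof -
    define y where "y = (\<lambda>i. if i \<in> {1..n} then ln (x i) else 0)"
    have y: "exp (y i) = x i" if "i \<in> {0..n}" for i using x that by (auto simp: y_def)
    have "\<epsilon> ^ card {i. y i \<noteq> 0} * exp (\<Sum>i\<in>{1..n}. y i * real (\<kappa> i)) * wsum (pmf \<mu>) \<alpha> (\<lambda>_. 0) (\<lambda>_. 1)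
      \<le> wsum (pmf \<mu>) \<alpha> (\<lambda>i. 0 + y i) (\<lambda>_. 1)"
    proof (rule capacity_log[OF st e e1])
      fix s :: real and T assume s: "s = 1 \<or> s = -1" and T: "T \<subseteq> {i. s * y i > 0}"
      have "T \<subseteq> {1..n}" using T by (auto simp: y_def split: if_splits)
      from close[OF this] show "s * (avg (pmf \<mu>) \<alpha> (\<lambda>_. 0) T - (\<Sum>i\<in>T. real (\<kappa> i))) \<ge> \<epsilon> - 1"
        unfolding avg[OF \<open>T \<subseteq> {1..n}\<close>] using s by (auto simp: abs_le_iff)
    qed (auto simp: y_def)
    also have "wsum (pmf \<mu>) \<alpha> (\<lambda>i. 0 + y i) (\<lambda>_. 1) = ev (pmf \<mu>) \<alpha> x"
      unfolding wsum_one by (rule ev_cong) (simp add: y)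
    also have "exp (\<Sum>i\<in>{1..n}. y i * real (\<kappa> i)) = (\<Prod>i\<in>{1..n}. x i ^ \<kappa> i)"
      unfolding exp_sum[OF finite_atLeastAtMost] using y by (intro prod.cong) (auto simp: exp_of_nat2_mult)
    finally have "\<epsilon> ^ card {i. y i \<noteq> 0} * (\<Prod>i\<in>{1..n}. x i ^ \<kappa> i) \<le> ev (pmf \<mu>) \<alpha> x" by (simp add: one)
    moreover have "card {i. y i \<noteq> 0} \<le> card {1..n}" by (rule card_mono) (auto simp: y_def split: if_splits)
    then have "\<epsilon> ^ n \<le> \<epsilon> ^ card {i. y i \<noteq> 0}" using e e1 by (intro power_decreasing) auto
    then have "\<epsilon> ^ n * (\<Prod>i\<in>{1..n}. x i ^ \<kappa> i) \<le> \<epsilon> ^ card {i. y i \<noteq> 0} * (\<Prod>i\<in>{1..n}. x i ^ \<kappa> i)"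
      using x(1) by (intro mult_right_mono prod_nonneg zero_le_power) (auto intro: less_imp_le)
    ultimately show ?thesis by linarith
  qed
  have "\<epsilon> ^ n * (\<Prod>i\<in>{i\<in>{1..n}. \<kappa> i > 0}. 1 / (exp 1 * sqrt (real (\<kappa> i))))
      \<le> \<epsilon> ^ n * (\<Prod>i\<in>{i\<in>{1..n}. \<kappa> i > 0}. real (\<kappa> i) ^ \<kappa> i * exp (- real (\<kappa> i)) / fact (\<kappa> i))"
  proof -
    have "1 / (exp 1 * sqrt (real k)) \<le> real k ^ k * exp (- real k) / fact k" if "k > 0" for k
      using fact_le_Stirling[of k] that by (simp add: divide_le_eq pos_le_divide_eq mult_ac)
    then show ?thesis using e by (intro mult_left_mono prod_mono) auto
  qed
  \<comment> \<open>Indices with \<kappa> = 0 contribute 0^0 exp 0 / 0! = 1.\<close>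
  also have "(\<Prod>i\<in>{i\<in>{1..n}. \<kappa> i > 0}. real (\<kappa> i) ^ \<kappa> i * exp (- real (\<kappa> i)) / fact (\<kappa> i)) =
      (\<Prod>i\<in>{1..n}. real (\<kappa> i) ^ \<kappa> i * exp (- real (\<kappa> i)) / fact (\<kappa> i))"
    by (rule prod.mono_neutral_left) auto
  also have "\<epsilon> ^ n * \<dots> \<le> (\<Sum>T | T \<in> K \<and> (\<forall>i\<in>{1..n}. \<alpha> T i = \<kappa> i). pmf \<mu> T)"
    using e by (intro coefficient_ge[OF st _ _ cap]) auto
  also have "\<dots> = measure_pmf.prob \<mu> {T \<in> K. \<forall>i\<in>{1..n}. \<alpha> T i = \<kappa> i}"
    using fin(2) by (subst measure_measure_pmf_finite) auto
  also have "\<dots> \<le> measure_pmf.prob \<mu> {T. \<forall>i\<in>{1..n}. count_in D i T = \<kappa> i}"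
    using \<alpha> by (intro measure_pmf.finite_measure_mono) auto
  finally show ?thesis .
qed

section \<open>The extremal example: independent coins linking consecutive blocks\<close>

lemma strongly_Rayleigh_tight:
  fixes n :: nat and \<kappa> :: "nat \<Rightarrow> nat" and \<epsilon> :: real
  assumes \<kappa>: "\<And>i. i \<in> {1..n} \<Longrightarrow> \<kappa> i > 0" and \<epsilon>: "0 < \<epsilon>" "\<epsilon> \<le> 1"
  obtains m \<mu> D where "strongly_rayleigh m \<mu>" "disjoint_subsets m n D"
    "\<And>S. S \<subseteq> {1..n} \<Longrightarrow>
       \<bar>measure_pmf.expectation \<mu> (\<lambda>T. \<Sum>i\<in>S. real (count_in D i T)) - (\<Sum>i\<in>S. real (\<kappa> i))\<bar> \<le> 1 - \<epsilon>"
    "measure_pmf.prob \<mu> {T. \<forall>i\<in>{1..n}. count_in D i T = \<kappa> i} \<le> \<epsilon> ^ n"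
proof -
  define A where "A = {1..n}"
  \<comment> \<open>The successor keeps the labels positive, as the ground set starts at 1.\<close>
  define code where "code = (\<lambda>i k. Suc (prod_encode (i, k)))"
  have code_eq [simp]: "code i k = code i' k' \<longleftrightarrow> i = i' \<and> k = k'" for i k i' k' by (simp add: code_def)
  define fixed where "fixed = (\<Union>i\<in>A. code i ` {2..\<kappa> i})"
  \<comment> \<open>Coin \<open>j\<close> selects an element of block \<open>j\<close> on success
    and of block \<open>j - 1\<close> on failure; for j = 1 the latter lies outside every
    \<open>D i\<close>. Together with the \<kappa> - 1 fixed elements of each block, this realises
    the product of linear forms.\<close>
  define pick where "pick = (\<lambda>f j. if f j then code j 0 else code (j - 1) 1)"
  define T where "T = (\<lambda>f. fixed \<union> pick f ` A)"
  define D where "D = (\<lambda>i. code i ` {0..\<kappa> i})"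
  define M where "M = Pi_pmf A False (\<lambda>_. bernoulli_pmf \<epsilon>)"
  define \<mu> where "\<mu> = map_pmf T M"
  \<comment> \<open>The upper limit \<open>Suc (\<kappa> i)\<close> ensures that
    \<open>code 0 1\<close> is included even when \<kappa> 0 = 0.\<close>
  define U where "U = (\<Union>i\<in>{0..n}. code i ` {0..Suc (\<kappa> i)})"
  define m where "m = Max U"
  have finA: "finite A" by (simp add: A_def)
  have finM: "finite (set_pmf M)"
    unfolding M_def using finA by (intro finite_subset[OF set_Pi_pmf_subset']) (auto intro!: finite_PiE_dflt)
  have "finite U" by (simp add: U_def)
  then have U: "U \<subseteq> {1..m}"
  proof -
    have "a \<ge> 1 \<and> a \<le> m" if "a \<in> U" for a
      using Max_ge[OF \<open>finite U\<close> that] that by (auto simp: m_def U_def code_def)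
    then show ?thesis by auto
  qed
  have code_U: "code i k \<in> U" if "i \<le> n" "k \<le> Suc (\<kappa> i)" for i k
    unfolding U_def using that by (intro UN_I[of i] imageI) auto
  have TU: "T f \<subseteq> U" for f
    by (auto simp: T_def fixed_def pick_def A_def intro!: code_U)
  have T_m: "T f \<subseteq> {1..m}" for f using TU U by blast
  have disj: "disjoint_subsets m n D"
    unfolding disjoint_subsets_def disjoint_family_on_def
  proof (intro conjI ballI impI)
    show "D i \<subseteq> {1..m}" if "i \<in> {1..n}" for i
      unfolding D_def using that code_U by (intro image_subsetI subsetD[OF U]) auto
  qed (auto simp: D_def)
  have count: "count_in D i (T f) = \<kappa> i - 1 + (if f i then 1 else 0) + (if i < n \<and> \<not> f (Suc i) then 1 else 0)"
    if "i \<in> A" for f i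
  proof -
    have "\<kappa> i > 0" using \<kappa> that by (simp add: A_def)
    have "T f \<inter> D i = code i ` ({2..\<kappa> i} \<union> (if f i then {0} else {}) \<union> (if i < n \<and> \<not> f (Suc i) then {1} else {}))"
      (is "?L = code i ` ?R")
    proof (rule set_eqI)
      fix a
      show "a \<in> ?L \<longleftrightarrow> a \<in> code i ` ?R"
      proof
        assume a: "a \<in> ?L"
        then obtain k where k: "a = code i k" "k \<le> \<kappa> i" by (auto simp: D_def)
        have "a \<in> fixed \<or> (\<exists>j\<in>A. a = pick f j)" using a by (auto simp: T_def)
        then have "k \<in> ?R"
          using k by (auto simp: fixed_def pick_def A_def split: if_splits)
        then show "a \<in> code i ` ?R" using k by blast
      next
        assume "a \<in> code i ` ?R"
        then obtain k where k: "a = code i k" "k \<in> ?R" by blast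
        have "code i 0 \<in> pick f ` A" if "f i"
          using that \<open>i \<in> A\<close> by (auto simp: pick_def intro!: image_eqI[of _ _ i])
        moreover have "code i 1 \<in> pick f ` A" if "i < n" "\<not> f (Suc i)"
          using that \<open>i \<in> A\<close> by (auto simp: pick_def A_def intro!: image_eqI[of _ _ "Suc i"])
        moreover have "code i k \<in> fixed" if "2 \<le> k" "k \<le> \<kappa> i"
          unfolding fixed_def using that \<open>i \<in> A\<close> by (intro UN_I[of i] imageI) auto
        ultimately show "a \<in> ?L"
          using k \<open>i \<in> A\<close> \<open>\<kappa> i > 0\<close> by (auto simp: T_def D_def split: if_splits)
      qed
    qed
    then have "count_in D i (T f) = card (code i ` ?R)" by (simp add: count_in_def)
    also have "\<dots> = card ?R" by (intro card_image inj_onI) simp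
    also have "\<dots> = \<kappa> i - 1 + (if f i then 1 else 0) + (if i < n \<and> \<not> f (Suc i) then 1 else 0)"
      using \<open>\<kappa> i > 0\<close> by (auto simp: card_insert_if)
    finally show ?thesis .
  qed
  have sr: "strongly_rayleigh m \<mu>"
    unfolding strongly_rayleigh_def
  proof (intro conjI allI impI)
    show "set_pmf \<mu> \<subseteq> Pow {1..m}" using T_m by (auto simp: \<mu>_def)
    fix z :: "nat \<Rightarrow> complex" assume z: "\<forall>e\<in>{1..m}. Im (z e) > 0"
    then have zU: "Im (z e) > 0" if "e \<in> U" for e using that U by blast
    \<comment> \<open>Coin outcomes are encoded by the set of successes, so that the expectation
      becomes the subset expansion of a product of sums.\<close>
    define F where "F = (\<lambda>J j. j \<in> (J :: nat set))"
    have inj: "inj_on F X" for X by (auto simp: F_def inj_on_def fun_eq_iff)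
    have "generating_poly m \<mu> z = measure_pmf.expectation \<mu> (\<lambda>S. \<Prod>e\<in>S. z e)"
      unfolding generating_poly_def using T_m
      by (subst integral_measure_pmf[of "Pow {1..m}"]) (auto simp: \<mu>_def scaleR_conv_of_real)
    also have "\<dots> = measure_pmf.expectation M (\<lambda>f. \<Prod>e\<in>T f. z e)" by (simp add: \<mu>_def)
    also have "\<dots> = (\<Sum>f\<in>F ` Pow A. pmf M f *\<^sub>R (\<Prod>e\<in>T f. z e))"
    proof (rule integral_measure_pmf)
      fix f assume "f \<in> set_pmf M"
      then have "f j = False" if "j \<notin> A" for j
        using that finA set_Pi_pmf_subset[of A False "\<lambda>_. bernoulli_pmf \<epsilon>"] by (auto simp: M_def)
      then have "f = F {j \<in> A. f j}" by (auto simp: F_def)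
      then show "f \<in> F ` Pow A" by blast
    qed (use finA in simp)
    also have "\<dots> = (\<Sum>J\<in>Pow A. of_real (pmf M (F J)) * (\<Prod>e\<in>T (F J). z e))"
      by (subst sum.reindex[OF inj]) (simp add: scaleR_conv_of_real)
    also have "\<dots> = (\<Sum>J\<in>Pow A. (\<Prod>e\<in>fixed. z e) *
        ((\<Prod>j\<in>J. of_real \<epsilon> * z (code j 0)) * (\<Prod>j\<in>A-J. of_real (1 - \<epsilon>) * z (code (j - 1) 1))))"
    proof (intro sum.cong refl)
      fix J assume "J \<in> Pow A"
      then have J: "J \<subseteq> A" "A \<inter> J = J" "A \<inter> {j. j \<notin> J} = A - J" by auto
      have split: "(\<Prod>j\<in>A. if j \<in> J then g j else h j) = (\<Prod>j\<in>J. g j) * (\<Prod>j\<in>A-J. h j)"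
        for g h :: "nat \<Rightarrow> 'a::comm_monoid_mult"
        using finA J by (simp add: prod.If_cases Collect_mem_eq Compl_eq)
      have "pmf M (F J) = (\<Prod>j\<in>A. if j \<in> J then \<epsilon> else 1 - \<epsilon>)"
        unfolding M_def using finA J \<epsilon> by (subst pmf_Pi') (auto simp: F_def intro!: prod.cong)
      then have pmf: "complex_of_real (pmf M (F J)) = (\<Prod>j\<in>J. of_real \<epsilon>) * (\<Prod>j\<in>A-J. of_real (1 - \<epsilon>))"
        by (simp only: split of_real_mult of_real_prod)
      have "finite fixed" "fixed \<inter> pick (F J) ` A = {}" using finA by (auto simp: fixed_def pick_def)
      then have "(\<Prod>e\<in>T (F J). z e) = (\<Prod>e\<in>fixed. z e) * (\<Prod>e\<in>pick (F J) ` A. z e)"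
        unfolding T_def using finA by (intro prod.union_disjoint) auto
      also have "(\<Prod>e\<in>pick (F J) ` A. z e) = (\<Prod>j\<in>A. z (pick (F J) j))"
        by (subst prod.reindex) (auto simp: inj_on_def pick_def A_def split: if_splits)
      also have "\<dots> = (\<Prod>j\<in>A. if j \<in> J then z (code j 0) else z (code (j - 1) 1))"
        by (intro prod.cong) (auto simp: pick_def F_def)
      finally show "of_real (pmf M (F J)) * (\<Prod>e\<in>T (F J). z e) = (\<Prod>e\<in>fixed. z e) *
        ((\<Prod>j\<in>J. of_real \<epsilon> * z (code j 0)) * (\<Prod>j\<in>A-J. of_real (1 - \<epsilon>) * z (code (j - 1) 1)))"
        unfolding pmf split prod.distrib by (simp only: mult_ac)
    qed
    also have "\<dots> = (\<Prod>e\<in>fixed. z e) * (\<Prod>j\<in>A. of_real \<epsilon> * z (code j 0) + of_real (1 - \<epsilon>) * z (code (j - 1) 1))"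
      by (subst prod_add[OF finA]) (simp only: sum_distrib_left)
    also have "\<dots> \<noteq> 0"
    proof -
      have "z e \<noteq> 0" if "e \<in> fixed" for e
        using zU[of e] TU that by (force simp: T_def)
      \<comment> \<open>Each factor is a convex combination of two points of the upper
        half-plane.\<close>
      moreover have "of_real \<epsilon> * z (code j 0) + of_real (1 - \<epsilon>) * z (code (j - 1) 1) \<noteq> 0" if "j \<in> A" for j
      proof -
        have "Im (z (code j 0)) > 0" "Im (z (code (j - 1) 1)) > 0"
          using that by (auto intro!: zU code_U simp: A_def)
        then have "Im (of_real \<epsilon> * z (code j 0) + of_real (1 - \<epsilon>) * z (code (j - 1) 1)) > 0"
          using \<epsilon> by (simp add: add_pos_nonneg)
        then show ?thesis by (metis less_irrefl zero_complex.sel(2))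
      qed
      ultimately show ?thesis using finA by (simp add: prod_zero_iff fixed_def)
    qed
    finally show "generating_poly m \<mu> z \<noteq> 0" .
  qed
  \<comment> \<open>For i < n the loss 1 - \<epsilon> of coin \<open>i\<close> is balanced by the
    failures of coin \<open>i + 1\<close>. Only block \<open>n\<close> has a deficit, so every
    partial sum deviates by 0 or 1 - \<epsilon>.\<close>
  have mean: "measure_pmf.expectation M (\<lambda>f. real (count_in D i (T f))) = real (\<kappa> i) - (if i = n then 1 - \<epsilon> else 0)"
    if "i \<in> A" for i
  proof -
    have comp: "measure_pmf.expectation M (\<lambda>f. g (f j)) = g True * \<epsilon> + g False * (1 - \<epsilon>)" if "j \<in> A" for g :: "bool \<Rightarrow> real" and j
    proof -
      have "measure_pmf.expectation M (\<lambda>f. g (f j)) = measure_pmf.expectation (map_pmf (\<lambda>f. f j) M) g" by simp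
      also have "map_pmf (\<lambda>f. f j) M = bernoulli_pmf \<epsilon>"
        unfolding M_def using finA that by (simp add: Pi_pmf_component)
      finally show ?thesis using \<epsilon> by simp
    qed
    have int: "integrable M g" for g :: "(nat \<Rightarrow> bool) \<Rightarrow> real"
      by (rule integrable_measure_pmf_finite[OF finM])
    have "measure_pmf.expectation M (\<lambda>f. real (count_in D i (T f))) =
       measure_pmf.expectation M (\<lambda>f. real (\<kappa> i - 1) + (if f i then 1 else 0) + (if i < n then if f (Suc i) then 0 else 1 else 0))"
      by (intro Bochner_Integration.integral_cong) (auto simp: count[OF that])
    also have "\<dots> = real (\<kappa> i - 1) + measure_pmf.expectation M (\<lambda>f. if f i then 1 else 0)
       + measure_pmf.expectation M (\<lambda>f. if i < n then if f (Suc i) then 0 else 1 else 0)"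
      by (simp add: int)
    also have "measure_pmf.expectation M (\<lambda>f. if f i then 1 else 0) = \<epsilon>"
      using comp[OF that, of "\<lambda>b. if b then 1 else 0"] by simp
    also have "measure_pmf.expectation M (\<lambda>f. if i < n then if f (Suc i) then 0 else 1 else 0) = (if i = n then 0 else 1 - \<epsilon>)"
      using comp[of "Suc i" "\<lambda>b. if b then 0 else 1"] that by (auto simp: A_def)
    also have "real (\<kappa> i - 1) = real (\<kappa> i) - 1" using \<kappa>[of i] that by (simp add: A_def of_nat_diff Suc_le_eq)
    finally show ?thesis by simp
  qed
  have close: "\<bar>measure_pmf.expectation \<mu> (\<lambda>T. \<Sum>i\<in>S. real (count_in D i T)) - (\<Sum>i\<in>S. real (\<kappa> i))\<bar> \<le> 1 - \<epsilon>"
    if "S \<subseteq> {1..n}" for S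
  proof -
    have S: "S \<subseteq> A" "finite S" using that finA finite_subset by (auto simp: A_def)
    have "measure_pmf.expectation \<mu> (\<lambda>T. \<Sum>i\<in>S. real (count_in D i T)) =
        (\<Sum>i\<in>S. measure_pmf.expectation M (\<lambda>f. real (count_in D i (T f))))"
      by (simp add: \<mu>_def integrable_measure_pmf_finite[OF finM])
    also have "\<dots> = (\<Sum>i\<in>S. real (\<kappa> i) - (if i = n then 1 - \<epsilon> else 0))"
      using S mean by (intro sum.cong) auto
    also have "\<dots> = (\<Sum>i\<in>S. real (\<kappa> i)) - (if n \<in> S then 1 - \<epsilon> else 0)"
      using S by (simp add: sum_subtractf)
    finally show ?thesis using \<epsilon> by simp
  qed
  \<comment> \<open>Block \<open>n\<close> receives nothing from a later coin, so reaching \<kappa>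
    n forces its own coin to succeed. Then block n - 1 receives nothing either, and the argument
    runs downwards through all coins.\<close>
  have all_true: "f j" if f: "\<forall>i\<in>A. count_in D i (T f) = \<kappa> i" and j: "j \<le> n" "j \<ge> 1" for f j
    using j
  proof (induction j rule: inc_induct)
    case base
    then show ?case using f count[of n f] \<kappa>[of n] by (auto simp: A_def split: if_splits)
  next
    case (step j)
    then show ?case using f count[of j f] \<kappa>[of j] by (auto simp: A_def split: if_splits)
  qed
  have "measure_pmf.prob \<mu> {T. \<forall>i\<in>{1..n}. count_in D i T = \<kappa> i} =
      measure_pmf.prob M {f. \<forall>i\<in>A. count_in D i (T f) = \<kappa> i}"
    by (simp add: \<mu>_def A_def vimage_def)
  also have "\<dots> \<le> measure_pmf.prob M (Pi A (\<lambda>_. {True}))"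
    using all_true by (intro measure_pmf.finite_measure_mono) (auto simp: A_def)
  also have "\<dots> = \<epsilon> ^ n"
    unfolding M_def using finA \<epsilon> by (simp add: measure_Pi_pmf_Pi measure_pmf_single A_def)
  finally show ?thesis using that[OF sr disj close] by blast
qed

theorem theorem2p6:
  fixes n :: nat and \<kappa> :: "nat \<Rightarrow> int"
  assumes "\<forall>i\<in>{1..n}. \<kappa> i \<ge> 0"
  shows "(\<forall>(m::nat) (\<mu> :: nat set pmf) (D :: nat \<Rightarrow> nat set) (\<epsilon>::real).
            strongly_rayleigh m \<mu> \<longrightarrow> disjoint_subsets m n D \<longrightarrow> \<epsilon> > 0 \<longrightarrow>
            (\<forall>S\<subseteq>{1..n}.
               \<bar>measure_pmf.expectation \<mu> (\<lambda>T. \<Sum>i\<in>S. real (count_in D i T))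
                 - (\<Sum>i\<in>S. real_of_int (\<kappa> i))\<bar> \<le> 1 - \<epsilon>) \<longrightarrow>
            measure_pmf.prob \<mu> {T. \<forall>i\<in>{1..n}. int (count_in D i T) = \<kappa> i}
              \<ge> \<epsilon> ^ n * (\<Prod>i\<in>{i\<in>{1..n}. \<kappa> i > 0}. 1 / (exp 1 * sqrt (real_of_int (\<kappa> i)))))
       \<and> ((\<forall>i\<in>{1..n}. \<kappa> i > 0) \<longrightarrow>
            (\<exists>C::real. \<forall>\<epsilon>::real. 0 < \<epsilon> \<and> \<epsilon> \<le> 1 \<longrightarrow>
               (\<exists>(m::nat) (\<mu> :: nat set pmf) (D :: nat \<Rightarrow> nat set).
                  strongly_rayleigh m \<mu> \<and> disjoint_subsets m n D \<and>
                  (\<forall>S\<subseteq>{1..n}.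
                     \<bar>measure_pmf.expectation \<mu> (\<lambda>T. \<Sum>i\<in>S. real (count_in D i T))
                       - (\<Sum>i\<in>S. real_of_int (\<kappa> i))\<bar> \<le> 1 - \<epsilon>) \<and>
                  measure_pmf.prob \<mu> {T. \<forall>i\<in>{1..n}. int (count_in D i T) = \<kappa> i} \<le> C * \<epsilon> ^ n)))"
proof (intro conjI allI impI)
  define k where "k = (\<lambda>i. nat (\<kappa> i))"
  have \<kappa>: "real_of_int (\<kappa> i) = real (k i)" "int a = \<kappa> i \<longleftrightarrow> a = k i" "\<kappa> i > 0 \<longleftrightarrow> k i > 0"
    if "i \<in> {1..n}" for i a using assms that by (auto simp: k_def)
  have sum: "(\<Sum>i\<in>S. real_of_int (\<kappa> i)) = (\<Sum>i\<in>S. real (k i))" if "S \<subseteq> {1..n}" for S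
    using that \<kappa>(1) by (intro sum.cong) auto
  have event: "{T. \<forall>i\<in>{1..n}. int (count_in D i T) = \<kappa> i} = {T. \<forall>i\<in>{1..n}. count_in D i T = k i}" for D
    using \<kappa>(2) by blast
  {
    fix m :: nat and \<mu> :: "nat set pmf" and D :: "nat \<Rightarrow> nat set" and \<epsilon> :: real
    assume *: "strongly_rayleigh m \<mu>" "disjoint_subsets m n D" "\<epsilon> > 0"
      "\<forall>S\<subseteq>{1..n}. \<bar>measure_pmf.expectation \<mu> (\<lambda>T. \<Sum>i\<in>S. real (count_in D i T))
         - (\<Sum>i\<in>S. real_of_int (\<kappa> i))\<bar> \<le> 1 - \<epsilon>"
    have close: "\<bar>measure_pmf.expectation \<mu> (\<lambda>T. \<Sum>i\<in>S. real (count_in D i T)) - (\<Sum>i\<in>S. real (k i))\<bar> \<le> 1 - \<epsilon>"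
      if "S \<subseteq> {1..n}" for S using *(4)[rule_format, OF that] unfolding sum[OF that] .
    have "(\<Prod>i\<in>{i\<in>{1..n}. \<kappa> i > 0}. 1 / (exp 1 * sqrt (real_of_int (\<kappa> i)))) =
        (\<Prod>i\<in>{i\<in>{1..n}. k i > 0}. 1 / (exp 1 * sqrt (real (k i))))"
      using \<kappa> by (intro prod.cong) auto
    then show "measure_pmf.prob \<mu> {T. \<forall>i\<in>{1..n}. int (count_in D i T) = \<kappa> i}
        \<ge> \<epsilon> ^ n * (\<Prod>i\<in>{i\<in>{1..n}. \<kappa> i > 0}. 1 / (exp 1 * sqrt (real_of_int (\<kappa> i))))"
      unfolding event by (simp only: strongly_Rayleigh_lower_bound[OF *(1-3) close])
  next
    assume pos: "\<forall>i\<in>{1..n}. \<kappa> i > 0"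
    show "\<exists>C::real. \<forall>\<epsilon>::real. 0 < \<epsilon> \<and> \<epsilon> \<le> 1 \<longrightarrow>
               (\<exists>(m::nat) (\<mu> :: nat set pmf) (D :: nat \<Rightarrow> nat set).
                  strongly_rayleigh m \<mu> \<and> disjoint_subsets m n D \<and>
                  (\<forall>S\<subseteq>{1..n}.
                     \<bar>measure_pmf.expectation \<mu> (\<lambda>T. \<Sum>i\<in>S. real (count_in D i T))
                       - (\<Sum>i\<in>S. real_of_int (\<kappa> i))\<bar> \<le> 1 - \<epsilon>) \<and>
                  measure_pmf.prob \<mu> {T. \<forall>i\<in>{1..n}. int (count_in D i T) = \<kappa> i} \<le> C * \<epsilon> ^ n)"
    \<comment> \<open>The example has probability at most \<epsilon>^n, so the constant 1 serves for
      every \<kappa>.\<close>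
    proof (rule exI[of _ 1], intro allI impI)
      fix \<epsilon> :: real assume \<epsilon>: "0 < \<epsilon> \<and> \<epsilon> \<le> 1"
      have "k i > 0" if "i \<in> {1..n}" for i using pos \<kappa>(3)[OF that] that by auto
      then obtain m \<mu> D where ex: "strongly_rayleigh m \<mu>" "disjoint_subsets m n D"
        "\<And>S. S \<subseteq> {1..n} \<Longrightarrow>
           \<bar>measure_pmf.expectation \<mu> (\<lambda>T. \<Sum>i\<in>S. real (count_in D i T)) - (\<Sum>i\<in>S. real (k i))\<bar> \<le> 1 - \<epsilon>"
        "measure_pmf.prob \<mu> {T. \<forall>i\<in>{1..n}. count_in D i T = k i} \<le> \<epsilon> ^ n"
        using strongly_Rayleigh_tight[of n k \<epsilon>] \<epsilon> by blast
      show "\<exists>(m::nat) (\<mu> :: nat set pmf) (D :: nat \<Rightarrow> nat set).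
                  strongly_rayleigh m \<mu> \<and> disjoint_subsets m n D \<and>
                  (\<forall>S\<subseteq>{1..n}.
                     \<bar>measure_pmf.expectation \<mu> (\<lambda>T. \<Sum>i\<in>S. real (count_in D i T))
                       - (\<Sum>i\<in>S. real_of_int (\<kappa> i))\<bar> \<le> 1 - \<epsilon>) \<and>
                  measure_pmf.prob \<mu> {T. \<forall>i\<in>{1..n}. int (count_in D i T) = \<kappa> i} \<le> 1 * \<epsilon> ^ n"
        unfolding event mult_1
        by (intro exI[of _ m] exI[of _ \<mu>] exI[of _ D] conjI allI impI ex(1,2,4)) (simp only: sum ex(3))
    qed
  }
qed

end
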